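(* Let $n \geq 1$. The set of strongly doubly reversible pairs in $\mathrm{PSp}(n,1)$ has Haar measure zero in $\mathrm{PSp}(n,1)\times \mathrm{PSp}(n,1)$.
   Context: $\mathbb{H}$ denotes Hamilton's quaternions and $\mathbb{H}^{n+1}$ is regarded as a right $\mathbb{H}$-vector space with the Hermitian form $\langle \mathbf z,\mathbf w\rangle = \bar w_{n+1} z_1 + \sum_{i=2}^{n} \bar w_i z_i + \bar w_1 z_{n+1}$. $\mathrm{Sp}(n,1)$ is the group of $(n+1)\times(n+1)$ quaternionic matrices preserving this form, and $\mathrm{PSp}(n,1)=\mathrm{Sp}(n,1)/\{\pm I\}$ (the isometry group of quaternionic hyperbolic $n$-space). For a group $G$, a pair $(g_1,g_2)\in G\times G$ is strongly doubly reversible if there is $g\in G$ with $g^2=1$ such that $g g_1 g^{-1}=g_1^{-1}$ and $g g_2 g^{-1}=g_2^{-1}$; equivalently, there are involutions $i_1,i_2,i_3\in G$ with $g_1=i_1i_2$, $g_2=i_1i_3$. *)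

theory Defs
  imports "HOL-Analysis.Analysis" "HOL-Algebra.Group"
begin

text \<open>A quaternion a + b i + c j + d k is represented by the vector (a,b,c,d) in real^4,
  with components q$1 (real part), q$2 (i), q$3 (j), q$4 (k).  Addition, negation and
  zero are the vector ones (and the topology is the Euclidean one); multiplication and
  conjugation follow Hamilton's rules i^2 = j^2 = k^2 = ijk = -1.\<close>

type_synonym quat = "real^4"

definition mk_quat :: "real \<Rightarrow> real \<Rightarrow> real \<Rightarrow> real \<Rightarrow> quat" where
  "mk_quat a b c d = (\<chi> i. if i = 1 then a else if i = 2 then b else if i = 3 then c else d)"

definition qmul :: "quat \<Rightarrow> quat \<Rightarrow> quat" where
  "qmul p q = mk_quat
     (p$1 * q$1 - p$2 * q$2 - p$3 * q$3 - p$4 * q$4)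
     (p$1 * q$2 + p$2 * q$1 + p$3 * q$4 - p$4 * q$3)
     (p$1 * q$3 - p$2 * q$4 + p$3 * q$1 + p$4 * q$2)
     (p$1 * q$4 + p$2 * q$3 - p$3 * q$2 + p$4 * q$1)"

definition qconj :: "quat \<Rightarrow> quat" where
  "qconj p = mk_quat (p$1) (- p$2) (- p$3) (- p$4)"

definition qone :: quat where
  "qone = mk_quat 1 0 0 0"

text \<open>Vectors of H^(n+1) are functions nat => quat (only the entries 1..n+1 matter);
  matrices are functions nat => nat => quat, indexed by 1..n+1, required to vanish
  outside this range.  H^(n+1) is a right H-vector space and matrices act on the left.\<close>

type_synonym qvec = "nat \<Rightarrow> quat"
type_synonym qmat = "nat \<Rightarrow> nat \<Rightarrow> quat"

definition qmat_apply :: "nat \<Rightarrow> qmat \<Rightarrow> qvec \<Rightarrow> qvec" where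
  "qmat_apply n A z = (\<lambda>i. \<Sum>k\<in>{1..n+1}. qmul (A i k) (z k))"

definition qmat_mult :: "nat \<Rightarrow> qmat \<Rightarrow> qmat \<Rightarrow> qmat" where
  "qmat_mult n A B = (\<lambda>i j. if i \<in> {1..n+1} \<and> j \<in> {1..n+1}
                            then (\<Sum>k\<in>{1..n+1}. qmul (A i k) (B k j)) else 0)"

definition qmat_id :: "nat \<Rightarrow> qmat" where
  "qmat_id n = (\<lambda>i j. if i \<in> {1..n+1} \<and> i = j then qone else 0)"

definition hform :: "nat \<Rightarrow> qvec \<Rightarrow> qvec \<Rightarrow> quat" where
  "hform n z w = qmul (qconj (w (n+1))) (z 1)
                 + (\<Sum>i\<in>{2..n}. qmul (qconj (w i)) (z i))
                 + qmul (qconj (w 1)) (z (n+1))"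

definition Sp :: "nat \<Rightarrow> qmat set" where
  "Sp n = {A. (\<forall>i j. \<not> (i \<in> {1..n+1} \<and> j \<in> {1..n+1}) \<longrightarrow> A i j = 0)
             \<and> (\<forall>z w. hform n (qmat_apply n A z) (qmat_apply n A w) = hform n z w)}"

text \<open>Sp(n,1) carries the subspace topology of the space of matrices
  (product topology on nat => nat => real^4, i.e. Euclidean on the finitely many
  relevant entries).\<close>

definition Sp_top :: "nat \<Rightarrow> qmat topology" where
  "Sp_top n = subtopology euclidean (Sp n)"

definition pcls :: "qmat \<Rightarrow> qmat set" where
  "pcls A = {A, - A}"

definition PSp_carrier :: "nat \<Rightarrow> qmat set set" where
  "PSp_carrier n = pcls ` Sp n"

definition PSp :: "nat \<Rightarrow> qmat set monoid" where
  "PSp n = \<lparr> carrier = PSp_carrier n,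
             mult = (\<lambda>X Y. {qmat_mult n A B | A B. A \<in> X \<and> B \<in> Y}),
             one = pcls (qmat_id n) \<rparr>"

definition PSp_top :: "nat \<Rightarrow> qmat set topology" where
  "PSp_top n = topology (\<lambda>U. U \<subseteq> PSp_carrier n \<and>
                              openin (Sp_top n) {A \<in> Sp n. pcls A \<in> U})"

definition strongly_doubly_reversible :: "('a, 'b) monoid_scheme \<Rightarrow> 'a \<Rightarrow> 'a \<Rightarrow> bool" where
  "strongly_doubly_reversible G g1 g2 \<longleftrightarrow>
     (\<exists>g \<in> carrier G. g \<otimes>\<^bsub>G\<^esub> g = \<one>\<^bsub>G\<^esub>
        \<and> g \<otimes>\<^bsub>G\<^esub> g1 \<otimes>\<^bsub>G\<^esub> inv\<^bsub>G\<^esub> g = inv\<^bsub>G\<^esub> g1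
        \<and> g \<otimes>\<^bsub>G\<^esub> g2 \<otimes>\<^bsub>G\<^esub> inv\<^bsub>G\<^esub> g = inv\<^bsub>G\<^esub> g2)"

definition borel_of_top :: "'a topology \<Rightarrow> 'a measure" where
  "borel_of_top T = sigma (topspace T) {U. openin T U}"

definition is_haar_measure ::
    "'a topology \<Rightarrow> ('a \<Rightarrow> 'a \<Rightarrow> 'a) \<Rightarrow> 'a measure \<Rightarrow> bool" where
  "is_haar_measure T mul \<mu> \<longleftrightarrow>
     sets \<mu> = sets (borel_of_top T) \<and> space \<mu> = topspace T
     \<and> (\<forall>g \<in> topspace T. \<forall>A \<in> sets \<mu>. emeasure \<mu> (mul g ` A) = emeasure \<mu> A)
     \<and> (\<forall>K. compactin T K \<longrightarrow> emeasure \<mu> K < \<infinity>)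
     \<and> (\<forall>U. openin T U \<and> U \<noteq> {} \<longrightarrow> emeasure \<mu> U > 0)
     \<and> (\<forall>A \<in> sets \<mu>. emeasure \<mu> A = (INF U \<in> {U. openin T U \<and> A \<subseteq> U}. emeasure \<mu> U))
     \<and> (\<forall>U. openin T U \<longrightarrow>
            emeasure \<mu> U = (SUP K \<in> {K. compactin T K \<and> K \<subseteq> U}. emeasure \<mu> K))"

text \<open>S has Haar measure zero: S is contained in a Borel set of measure zero for
  every Haar measure (Haar measures are unique up to a positive scalar).\<close>

definition haar_null :: "'a topology \<Rightarrow> ('a \<Rightarrow> 'a \<Rightarrow> 'a) \<Rightarrow> 'a set \<Rightarrow> bool" where
  "haar_null T mul S \<longleftrightarrow>
     (\<forall>\<mu>. is_haar_measure T mul \<mu> \<longrightarrow> (\<exists>N \<in> sets \<mu>. S \<subseteq> N \<and> emeasure \<mu> N = 0))"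

definition PSp2_top :: "nat \<Rightarrow> (qmat set \<times> qmat set) topology" where
  "PSp2_top n = prod_topology (PSp_top n) (PSp_top n)"

definition PSp2_mult :: "nat \<Rightarrow> qmat set \<times> qmat set \<Rightarrow> qmat set \<times> qmat set \<Rightarrow> qmat set \<times> qmat set" where
  "PSp2_mult n p q = (fst p \<otimes>\<^bsub>PSp n\<^esub> fst q, snd p \<otimes>\<^bsub>PSp n\<^esub> snd q)"

end

theory Submission
  imports Defs "HOL-Library.Function_Algebras"
begin

text \<open>If an element of PSp(n,1) conjugates the classes of a and b to their inverses, then
  Re tr (a a a b a b b b) = Re tr (b b b a b a a a): the difference of the two sides, the reversal
  defect, is invariant under simultaneous conjugation, changes its sign when a and b are replaced by
  their inverses, and does not notice the signs of a and b because both letters occur an even number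
  of times.  Hence the pairs in question lie in the zero set of a polynomial.

  Any pair (a, b) can be moved off this zero set by left multiplication with products of three
  transvections z \<mapsto> z + t v p \<langle>z, v\<rangle> (v isotropic, p imaginary): multiplied with a and rescaled,
  such products tend, as t grows, to arbitrary rank one matrices with isotropic image and coimage,
  and on a suitable pair of these the defect is -32.  So through every point y there is a curve
  x(t) y with x(0) = 1 along which the defect is a polynomial in t that is not identically zero, and
  the same holds for all w near y.  If E is the part of the zero set near y, then the translates
  of E by x(t)\<inverse>, for infinitely many small t, lie in one set of finite measure and cover each
  point only finitely often.  By left invariance, E is null.\<close>

section \<open>Topological groups and Haar measure\<close>

lemma tendsto_emeasure_finitely_overlapping:
  fixes A :: "nat \<Rightarrow> 'a set"
  assumes A: "\<And>j. A j \<in> sets M" "\<And>j. A j \<subseteq> W" and W: "W \<in> sets M" "emeasure M W < \<infinity>"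
    and finite: "\<And>w. finite {j. w \<in> A j}"
  shows "(\<lambda>j. emeasure M (A j)) \<longlonglongrightarrow> 0"
proof -
  define B where "B m = (\<Union>j\<in>{m..}. A j)" for m
  have B: "B m \<in> sets M" "B m \<subseteq> W" for m
    unfolding B_def using A by blast+
  have "w \<notin> (\<Inter>m. B m)" for w
  proof -
    obtain m where "{j. w \<in> A j} \<subseteq> {..<m}"
      using finite_nat_bounded[OF finite[of w]] ..
    then have "w \<notin> B m"
      by (fastforce simp: B_def)
    then show ?thesis
      by blast
  qed
  then have "(\<Inter>m. B m) = {}"
    by blast
  moreover have "(\<lambda>m. emeasure M (B m)) \<longlonglongrightarrow> emeasure M (\<Inter>m. B m)"
  proof (rule Lim_emeasure_decseq)
    show "decseq B"
      unfolding decseq_def B_def by (intro allI impI UN_mono) auto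
    show "emeasure M (B m) \<noteq> \<infinity>" for m
      using emeasure_mono[OF B(2) W(1)] W(2) by (metis leD infinity_ennreal_def)
  qed (use B in auto)
  ultimately have "(\<lambda>m. emeasure M (B m)) \<longlonglongrightarrow> 0"
    by simp
  moreover have "emeasure M (A m) \<le> emeasure M (B m)" for m
    by (rule emeasure_mono[OF _ B(1)]) (auto simp: B_def)
  ultimately show ?thesis
    using tendsto_sandwich[of "\<lambda>_. 0" "\<lambda>j. emeasure M (A j)" sequentially "\<lambda>m. emeasure M (B m)" 0]
    by simp
qed

lemma space_borel_of_top [simp]: "space (borel_of_top T) = topspace T"
  by (auto simp: borel_of_top_def space_measure_of_conv)

lemma sets_borel_of_top: "sets (borel_of_top T) = sigma_sets (topspace T) {U. openin T U}"
  unfolding borel_of_top_def by (rule sets_measure_of) (auto dest: openin_subset)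

lemma openin_in_sets_borel_of_top: "openin T U \<Longrightarrow> U \<in> sets (borel_of_top T)"
  by (simp add: sets_borel_of_top)

lemma closedin_in_sets_borel_of_top:
  assumes "closedin T C"
  shows "C \<in> sets (borel_of_top T)"
proof -
  have "topspace T - (topspace T - C) \<in> sets (borel_of_top T)"
    using assms openin_in_sets_borel_of_top[of T "topspace T - C"]
    by (metis closedin_def sets.compl_sets space_borel_of_top)
  then show ?thesis
    using closedin_subset[OF assms] by (simp add: double_diff)
qed

lemma measurable_borel_of_top_if_continuous_map:
  assumes "continuous_map S T f"
  shows "f \<in> measurable (borel_of_top S) (borel_of_top T)"
  unfolding borel_of_top_def[of T]
proof (rule measurable_measure_of)
  show "f -` U \<inter> space (borel_of_top S) \<in> sets (borel_of_top S)" if "U \<in> {U. openin T U}" for U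
    using assms that
    by (auto simp: continuous_map_def vimage_def Int_def conj_commute
        intro: openin_in_sets_borel_of_top)
qed (use assms in \<open>auto simp: continuous_map_def dest: openin_subset\<close>)

lemma haar_null_mono: "haar_null T mul N \<Longrightarrow> S \<subseteq> N \<Longrightarrow> haar_null T mul S"
  unfolding haar_null_def by (meson order_trans)

lemma open_map_prod:
  assumes "open_map S S' f" "open_map T T' g"
  shows "open_map (prod_topology S T) (prod_topology S' T') (map_prod f g)"
  unfolding open_map_def
proof (intro allI impI)
  fix W assume W: "openin (prod_topology S T) W"
  show "openin (prod_topology S' T') (map_prod f g ` W)"
    unfolding openin_prod_topology_alt
  proof (intro allI impI)
    fix x y assume "(x, y) \<in> map_prod f g ` W"
    then obtain a b where ab: "(a, b) \<in> W" "x = f a" "y = g b"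
      by auto
    obtain U V where UV: "openin S U" "openin T V" "a \<in> U" "b \<in> V" "U \<times> V \<subseteq> W"
      using W[unfolded openin_prod_topology_alt, rule_format, OF ab(1)] by blast
    have "f ` U \<times> g ` V = map_prod f g ` (U \<times> V)"
      by (rule map_prod_surj_on[OF refl refl, symmetric])
    also have "\<dots> \<subseteq> map_prod f g ` W"
      using UV(5) by (rule image_mono)
    finally show "\<exists>U V. openin S' U \<and> openin T' V \<and> x \<in> U \<and> y \<in> V \<and> U \<times> V \<subseteq> map_prod f g ` W"
      using assms UV(1-4) ab(2,3) unfolding open_map_def
      by (intro exI[of _ "f ` U"] exI[of _ "g ` V"]) simp
  qed
qed

lemma continuous_map_map_prod:
  assumes "continuous_map S S' f" "continuous_map T T' g"
  shows "continuous_map (prod_topology S T) (prod_topology S' T') (map_prod f g)"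
  using assms by (simp add: map_prod_def continuous_map_prod_top)

lemma Hausdorff_space_open_map_image:
  assumes f: "open_map S T f" "f ` topspace S = topspace T"
    and rel: "closedin (prod_topology S S) {(x, y) \<in> topspace S \<times> topspace S. f x = f y}"
  shows "Hausdorff_space T"
proof -
  let ?R = "{(x, y) \<in> topspace S \<times> topspace S. f x = f y}"
  have image: "map_prod f f ` (topspace S \<times> topspace S - ?R)
      = topspace T \<times> topspace T - (\<lambda>x. (x, x)) ` topspace T"
    unfolding f(2)[symmetric] by (auto simp: image_iff)
  have "openin (prod_topology S S) (topspace S \<times> topspace S - ?R)"
    using rel by (simp add: closedin_def)
  from open_map_prod[OF f(1) f(1), unfolded open_map_def, rule_format, OF this] image
  have "openin (prod_topology T T) (topspace T \<times> topspace T - (\<lambda>x. (x, x)) ` topspace T)"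
    by simp
  then show ?thesis
    by (auto simp: Hausdorff_space_closedin_diagonal closedin_def)
qed

lemma second_countable_euclidean:
  "second_countable (euclidean :: 'a::second_countable_topology topology)"
proof -
  obtain \<B> :: "'a set set" where \<B>: "countable \<B>" "topological_basis \<B>"
    using ex_countable_basis by blast
  then have "\<exists>B\<in>\<B>. x \<in> B \<and> B \<subseteq> U" if "open U" "x \<in> U" for x U
    using that by (metis topological_basisE)
  with \<B> show ?thesis
    unfolding second_countable_def by (metis open_openin topological_basis_open)
qed

locale topological_group = group G for G (structure) +
  fixes T :: "'a topology"
  assumes topspace_eq: "topspace T = carrier G"
    and continuous_mult: "continuous_map (prod_topology T T) T (\<lambda>(x, y). x \<otimes> y)"
    and continuous_inv: "continuous_map T T (\<lambda>x. inv x)"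
begin

lemma continuous_map_mult:
  assumes "continuous_map S T f" "continuous_map S T g"
  shows "continuous_map S T (\<lambda>x. f x \<otimes> g x)"
  using continuous_map_compose[OF continuous_map_pairedI[OF assms] continuous_mult]
  by (simp add: comp_def)

lemma continuous_map_m_inv:
  assumes "continuous_map S T f"
  shows "continuous_map S T (\<lambda>x. inv f x)"
  using continuous_map_compose[OF assms continuous_inv] by (simp add: comp_def)

lemma closedin_zero_set:
  fixes F :: "'a \<Rightarrow> real"
  assumes "continuous_map T euclideanreal F"
  shows "closedin T {x \<in> carrier G. F x = 0}"
  using closedin_continuous_map_preimage[OF assms, of "{0}"] by (simp add: topspace_eq)

lemma ex_neighbourhoods_translated_into:
  assumes \<gamma>: "continuous_map euclideanreal T \<gamma>" "\<gamma> 0 = \<one>"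
    and W: "openin T W" "y \<in> W"
  obtains I U where "open I" "0 \<in> I" "openin T U" "y \<in> U"
    "\<And>t x. t \<in> I \<Longrightarrow> x \<in> U \<Longrightarrow> inv (\<gamma> t) \<otimes> x \<in> W"
proof -
  let ?P = "{p \<in> UNIV \<times> carrier G. inv (\<gamma> (fst p)) \<otimes> snd p \<in> W}"
  have "continuous_map (prod_topology euclideanreal T) T (\<lambda>p. inv (\<gamma> (fst p)) \<otimes> snd p)"
    by (intro continuous_map_mult continuous_map_m_inv continuous_map_snd
        continuous_map_compose[OF continuous_map_fst \<gamma>(1), unfolded comp_def])
  from openin_continuous_map_preimage[OF this W(1)]
  have "openin (prod_topology euclideanreal T) ?P"
    by (simp add: topspace_eq)
  moreover have "(0, y) \<in> ?P"
    using W openin_subset[OF W(1)] \<gamma>(2) by (auto simp: topspace_eq)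
  ultimately have "\<exists>I U. openin euclideanreal I \<and> openin T U \<and> 0 \<in> I \<and> y \<in> U \<and> I \<times> U \<subseteq> ?P"
    unfolding openin_prod_topology_alt by simp
  then obtain I U where "openin euclideanreal I" "openin T U" "0 \<in> I" "y \<in> U" "I \<times> U \<subseteq> ?P"
    by (elim exE conjE)
  then show thesis
    by (intro that[of I U]) (auto simp: subset_eq)
qed

lemma left_translate_eq_preimage:
  assumes "g \<in> carrier G" "E \<subseteq> carrier G"
  shows "(\<otimes>) g ` E = {x \<in> carrier G. inv g \<otimes> x \<in> E}"
proof (intro equalityI subsetI)
  fix x assume "x \<in> (\<otimes>) g ` E"
  then show "x \<in> {x \<in> carrier G. inv g \<otimes> x \<in> E}"
    using assms by (auto simp: subset_eq inv_solve_left m_assoc[symmetric])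
next
  fix x assume x: "x \<in> {x \<in> carrier G. inv g \<otimes> x \<in> E}"
  then have "x = g \<otimes> (inv g \<otimes> x)"
    using assms(1) by (simp add: m_assoc[symmetric])
  with x show "x \<in> (\<otimes>) g ` E"
    by blast
qed

lemma left_translate_in_sets_borel:
  assumes g: "g \<in> carrier G" and E: "E \<in> sets (borel_of_top T)"
  shows "(\<otimes>) g ` E \<in> sets (borel_of_top T)"
proof -
  have "continuous_map T T (\<lambda>x. inv g \<otimes> x)"
    using g by (intro continuous_map_mult) (simp_all add: topspace_eq)
  then have "(\<lambda>x. inv g \<otimes> x) \<in> measurable (borel_of_top T) (borel_of_top T)"
    by (rule measurable_borel_of_top_if_continuous_map)
  from measurable_sets[OF this E]
  have "(\<lambda>x. inv g \<otimes> x) -` E \<inter> carrier G \<in> sets (borel_of_top T)"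
    by (simp add: topspace_eq)
  moreover have "E \<subseteq> carrier G"
    using sets.sets_into_space[OF E] by (simp add: topspace_eq)
  ultimately show ?thesis
    using left_translate_eq_preimage[OF g] by (simp add: vimage_def Int_def conj_commute)
qed

end

lemma topological_group_open_hom_image:
  assumes "topological_group G S" and "group H" and hom: "h \<in> hom G H"
    and h: "continuous_map S T h" "open_map S T h" "h ` topspace S = topspace T"
    and T: "topspace T = carrier H"
  shows "topological_group H T"
proof -
  interpret G: topological_group G S by fact
  interpret H: group H by fact
  interpret group_hom G H h
    using hom by unfold_locales
  have quotient: "quotient_map S T h"
    using h by (rule continuous_open_imp_quotient_map)
  have quotient2: "quotient_map (prod_topology S S) (prod_topology T T) (map_prod h h)"
    using h by (intro continuous_open_imp_quotient_map continuous_map_map_prod open_map_prod)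
      (simp_all add: map_prod_surj_on)
  show ?thesis
  proof
    have "continuous_map (prod_topology S S) T (\<lambda>p. h (fst p \<otimes>\<^bsub>G\<^esub> snd p))"
      using continuous_map_compose[OF G.continuous_mult h(1)] by (simp add: comp_def case_prod_beta)
    then have "continuous_map (prod_topology S S) T ((\<lambda>(x, y). x \<otimes>\<^bsub>H\<^esub> y) \<circ> map_prod h h)"
      by (rule continuous_map_eq) (auto simp: G.topspace_eq)
    then show "continuous_map (prod_topology T T) T (\<lambda>(x, y). x \<otimes>\<^bsub>H\<^esub> y)"
      using quotient2 by (rule continuous_compose_quotient_map[rotated])
    have "continuous_map S T (\<lambda>x. h (inv\<^bsub>G\<^esub> x))"
      using continuous_map_compose[OF G.continuous_inv h(1)] by (simp add: comp_def)
    then have "continuous_map S T ((\<lambda>x. inv\<^bsub>H\<^esub> x) \<circ> h)"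
      by (rule continuous_map_eq) (auto simp: G.topspace_eq)
    then show "continuous_map T T (\<lambda>x. inv\<^bsub>H\<^esub> x)"
      using quotient by (rule continuous_compose_quotient_map[rotated])
  qed (rule T)
qed

lemma topological_group_DirProd:
  assumes "topological_group G S" and "topological_group H T"
  shows "topological_group (G \<times>\<times> H) (prod_topology S T)"
proof -
  interpret G: topological_group G S by fact
  interpret H: topological_group H T by fact
  interpret GH: group "G \<times>\<times> H"
    by (rule DirProd_group[OF G.group_axioms H.group_axioms])
  let ?P = "prod_topology S T"
  show ?thesis
  proof
    have "continuous_map (prod_topology ?P ?P) S (\<lambda>p. fst (f p))"
      "continuous_map (prod_topology ?P ?P) T (\<lambda>p. snd (f p))"
      if "continuous_map (prod_topology ?P ?P) ?P f" for f
      using continuous_map_compose[OF that continuous_map_fst]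
        continuous_map_compose[OF that continuous_map_snd] by (simp_all add: comp_def)
    then show "continuous_map (prod_topology ?P ?P) ?P (\<lambda>(x, y). x \<otimes>\<^bsub>G \<times>\<times> H\<^esub> y)"
      unfolding case_prod_beta mult_DirProd'
      by (intro continuous_map_pairedI G.continuous_map_mult H.continuous_map_mult)
        (simp_all add: continuous_map_fst continuous_map_snd)
    have "continuous_map ?P ?P (\<lambda>x. (inv\<^bsub>G\<^esub> fst x, inv\<^bsub>H\<^esub> snd x))"
      by (intro continuous_map_pairedI G.continuous_map_m_inv H.continuous_map_m_inv
          continuous_map_fst continuous_map_snd)
    then show "continuous_map ?P ?P (\<lambda>x. inv\<^bsub>G \<times>\<times> H\<^esub> x)"
      by (rule continuous_map_eq)
        (auto simp: G.topspace_eq H.topspace_eq inv_DirProd[OF G.group_axioms H.group_axioms])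
  qed (simp add: G.topspace_eq H.topspace_eq)
qed

lemma finite_zeros_real_polynomial_function:
  fixes f :: "real \<Rightarrow> real"
  assumes "real_polynomial_function f" "f a \<noteq> 0"
  shows "finite {t. f t = 0}"
proof -
  obtain c n where f: "f = (\<lambda>t. \<Sum>i\<le>n. c i * t ^ i)"
    using assms(1) by (auto simp: real_polynomial_function_iff_sum)
  then have "\<exists>i\<le>n. c i \<noteq> 0"
    using assms(2) by (force intro: ccontr)
  then show ?thesis
    using f by (simp add: polyfun_finite_roots)
qed

locale haar_measure = topological_group +
  fixes \<mu> :: "'a measure"
  assumes haar: "is_haar_measure T (\<otimes>) \<mu>"
begin

lemma sets_haar: "sets \<mu> = sets (borel_of_top T)"
  and emeasure_left_translate: "g \<in> carrier G \<Longrightarrow> E \<in> sets \<mu> \<Longrightarrow> emeasure \<mu> ((\<otimes>) g ` E) = emeasure \<mu> E"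
  and emeasure_compact_finite: "compactin T K \<Longrightarrow> emeasure \<mu> K < \<infinity>"
  using haar by (simp_all add: is_haar_measure_def topspace_eq)

lemma openin_in_sets_haar: "openin T U \<Longrightarrow> U \<in> sets \<mu>"
  by (simp add: sets_haar openin_in_sets_borel_of_top)

lemma closedin_in_sets_haar: "closedin T C \<Longrightarrow> C \<in> sets \<mu>"
  by (simp add: sets_haar closedin_in_sets_borel_of_top)

lemma emeasure_0_if_translates_finitely_overlapping:
  fixes h :: "nat \<Rightarrow> 'a"
  assumes E: "E \<in> sets \<mu>" and W: "W \<in> sets \<mu>" "emeasure \<mu> W < \<infinity>"
    and h: "\<And>j. h j \<in> carrier G" "\<And>j. (\<otimes>) (h j) ` E \<subseteq> W"
    and finite: "\<And>w. w \<in> W \<Longrightarrow> finite {j. w \<in> (\<otimes>) (h j) ` E}"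
  shows "emeasure \<mu> E = 0"
proof -
  have "finite {j. w \<in> (\<otimes>) (h j) ` E}" for w
  proof (cases "w \<in> W")
    case False
    then have "{j. w \<in> (\<otimes>) (h j) ` E} = {}"
      using h(2) by blast
    then show ?thesis
      by (metis finite.emptyI)
  qed (rule finite)
  moreover have "(\<otimes>) (h j) ` E \<in> sets \<mu>" for j
    using E h(1) by (simp add: sets_haar left_translate_in_sets_borel)
  ultimately have "(\<lambda>j. emeasure \<mu> ((\<otimes>) (h j) ` E)) \<longlonglongrightarrow> 0"
    using h(2) W by (intro tendsto_emeasure_finitely_overlapping)
  then show ?thesis
    using E h(1) by (simp add: emeasure_left_translate LIMSEQ_const_iff)
qed

lemma ex_open_neighbourhood_finite_measure:
  assumes "locally_compact_space T" "Hausdorff_space T" and V: "openin T V" "y \<in> V"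
  obtains W where "openin T W" "y \<in> W" "W \<subseteq> V" "emeasure \<mu> W < \<infinity>"
proof -
  have "y \<in> topspace T"
    using V openin_subset by blast
  then obtain U K where U: "openin T U" "compactin T K" "y \<in> U" "U \<subseteq> K"
    using assms(1) unfolding locally_compact_space_def by blast
  have "emeasure \<mu> (V \<inter> U) \<le> emeasure \<mu> K"
    using U by (intro emeasure_mono closedin_in_sets_haar compactin_imp_closedin[OF assms(2)]) auto
  also have "\<dots> < \<infinity>"
    by (rule emeasure_compact_finite[OF U(2)])
  finally show thesis
    using U(1,3) V by (intro that[of "V \<inter> U"]) auto
qed

lemma locally_null_if_curve_leaves_finitely:
  assumes T: "locally_compact_space T" "Hausdorff_space T" and Z: "closedin T Z"
    and \<gamma>: "continuous_map euclideanreal T \<gamma>" "\<gamma> 0 = \<one>"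
    and V: "openin T V" "y \<in> V" and finite: "\<And>w. w \<in> V \<Longrightarrow> finite {t. \<gamma> t \<otimes> w \<in> Z}"
  obtains U where "openin T U" "y \<in> U" "Z \<inter> U \<in> null_sets \<mu>"
proof -
  have \<gamma>_closed: "\<gamma> t \<in> carrier G" for t
    using \<gamma>(1) by (auto simp: continuous_map_def topspace_eq)
  obtain W where W: "openin T W" "y \<in> W" "W \<subseteq> V" "emeasure \<mu> W < \<infinity>"
    using ex_open_neighbourhood_finite_measure[OF T V] .
  obtain I U where I: "open I" "0 \<in> I" and U: "openin T U" "y \<in> U"
    and IU: "\<And>t x. t \<in> I \<Longrightarrow> x \<in> U \<Longrightarrow> inv (\<gamma> t) \<otimes> x \<in> W"
    by (rule ex_neighbourhoods_translated_into[OF \<gamma> W(1,2)]) blast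
  have "infinite I"
    using I finite_imp_not_open[of I] by auto
  then obtain \<tau> :: "nat \<Rightarrow> real" where \<tau>: "inj \<tau>" "range \<tau> \<subseteq> I"
    using infinite_countable_subset by blast
  let ?h = "\<lambda>j. inv (\<gamma> (\<tau> j))"
  have E: "Z \<inter> U \<in> sets \<mu>"
    using Z U by (intro sets.Int closedin_in_sets_haar openin_in_sets_haar)
  have "emeasure \<mu> (Z \<inter> U) = 0"
  proof (rule emeasure_0_if_translates_finitely_overlapping[OF E])
    show "(\<otimes>) (?h j) ` (Z \<inter> U) \<subseteq> W" for j
      using IU \<tau>(2) by blast
    show "finite {j. w \<in> (\<otimes>) (?h j) ` (Z \<inter> U)}" if "w \<in> W" for w
    proof (rule finite_subset)
      show "finite (\<tau> -` {t. \<gamma> t \<otimes> w \<in> Z})"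
        using that W(3) finite \<tau>(1) by (intro finite_vimageI) auto
      have "\<gamma> t \<otimes> (inv (\<gamma> t) \<otimes> x) = x" if "x \<in> Z" for t x
        using that closedin_subset[OF Z] \<gamma>_closed[of t]
        by (auto simp: topspace_eq simp flip: m_assoc)
      then show "{j. w \<in> (\<otimes>) (?h j) ` (Z \<inter> U)} \<subseteq> \<tau> -` {t. \<gamma> t \<otimes> w \<in> Z}"
        by auto
    qed
  qed (use W \<gamma>_closed in \<open>simp_all add: openin_in_sets_haar\<close>)
  with E U show thesis
    by (intro that) auto
qed

lemma zero_set_locally_null_if_polynomial_curve:
  fixes F :: "'a \<Rightarrow> real"
  assumes T: "locally_compact_space T" "Hausdorff_space T"
    and F: "continuous_map T euclideanreal F"
    and \<gamma>: "continuous_map euclideanreal T \<gamma>" "\<gamma> 0 = \<one>"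
    and poly: "\<And>w. w \<in> carrier G \<Longrightarrow> real_polynomial_function (\<lambda>t. F (\<gamma> t \<otimes> w))"
    and y: "y \<in> carrier G" "F (\<gamma> s \<otimes> y) \<noteq> 0"
  obtains U where "openin T U" "y \<in> U" "{x \<in> carrier G. F x = 0} \<inter> U \<in> null_sets \<mu>"
proof (rule locally_null_if_curve_leaves_finitely[OF T _ \<gamma>])
  show "closedin T {x \<in> carrier G. F x = 0}"
    by (rule closedin_zero_set[OF F])
  have "\<gamma> s \<in> topspace T"
    using \<gamma>(1) by (auto simp: continuous_map_def)
  then have "continuous_map T euclideanreal (\<lambda>w. F (\<gamma> s \<otimes> w))"
    by (intro continuous_map_compose[OF continuous_map_mult F, unfolded comp_def]) simp_all
  from openin_continuous_map_preimage[OF this, of "- {0}"]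
  show "openin T {w \<in> carrier G. F (\<gamma> s \<otimes> w) \<noteq> 0}"
    by (simp add: topspace_eq open_Compl)
  show "finite {t. \<gamma> t \<otimes> w \<in> {x \<in> carrier G. F x = 0}}"
    if "w \<in> {w \<in> carrier G. F (\<gamma> s \<otimes> w) \<noteq> 0}" for w
  proof (rule finite_subset)
    show "finite {t. F (\<gamma> t \<otimes> w) = 0}"
      using that by (intro finite_zeros_real_polynomial_function[OF poly, of w s]) simp_all
  qed auto
qed (use y in auto)

lemma null_sets_if_locally_null:
  assumes "Lindelof_space T" and Z: "closedin T Z"
    and local: "\<And>y. y \<in> carrier G \<Longrightarrow> \<exists>U. openin T U \<and> y \<in> U \<and> Z \<inter> U \<in> null_sets \<mu>"
  shows "Z \<in> null_sets \<mu>"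
proof -
  define \<U> where "\<U> = {U. openin T U \<and> Z \<inter> U \<in> null_sets \<mu>}"
  have "\<Union>\<U> = topspace T"
    using local openin_subset[of T] unfolding \<U>_def topspace_eq by blast
  then obtain \<V> where \<V>: "countable \<V>" "\<V> \<subseteq> \<U>" "\<Union>\<V> = topspace T"
    using Lindelof_spaceD[OF assms(1), of \<U>] by (auto simp: \<U>_def)
  have "(\<Union>U\<in>\<V>. Z \<inter> U) \<in> null_sets \<mu>"
    using \<V>(1,2) by (intro null_sets_UN') (auto simp: \<U>_def)
  moreover have "(\<Union>U\<in>\<V>. Z \<inter> U) = Z"
    using \<V>(3) closedin_subset[OF Z] by blast
  ultimately show ?thesis
    by simp
qed

end

theorem (in topological_group) haar_null_zero_set:
  fixes F :: "'a \<Rightarrow> real"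
  assumes T: "Lindelof_space T" "locally_compact_space T" "Hausdorff_space T"
    and F: "continuous_map T euclideanreal F"
    and curves: "\<And>y. y \<in> carrier G \<Longrightarrow> \<exists>\<gamma>. continuous_map euclideanreal T \<gamma> \<and> \<gamma> 0 = \<one>
      \<and> (\<forall>w\<in>carrier G. real_polynomial_function (\<lambda>t. F (\<gamma> t \<otimes> w))) \<and> (\<exists>s. F (\<gamma> s \<otimes> y) \<noteq> 0)"
  shows "haar_null T (\<otimes>) {x \<in> carrier G. F x = 0}"
  unfolding haar_null_def
proof (intro allI impI)
  fix \<mu> assume "is_haar_measure T (\<otimes>) \<mu>"
  then interpret haar_measure G T \<mu>
    by unfold_locales
  have "{x \<in> carrier G. F x = 0} \<in> null_sets \<mu>"
  proof (rule null_sets_if_locally_null[OF T(1)])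
    show "closedin T {x \<in> carrier G. F x = 0}"
      by (rule closedin_zero_set[OF F])
    fix y assume y: "y \<in> carrier G"
    obtain \<gamma> s where \<gamma>: "continuous_map euclideanreal T \<gamma>" "\<gamma> 0 = \<one>" "F (\<gamma> s \<otimes> y) \<noteq> 0"
      and poly: "\<And>w. w \<in> carrier G \<Longrightarrow> real_polynomial_function (\<lambda>t. F (\<gamma> t \<otimes> w))"
      using curves[OF y] by blast
    obtain U where "openin T U" "y \<in> U" "{x \<in> carrier G. F x = 0} \<inter> U \<in> null_sets \<mu>"
      by (rule zero_set_locally_null_if_polynomial_curve[OF T(2,3) F \<gamma>(1,2) poly y \<gamma>(3)])
    then show "\<exists>U. openin T U \<and> y \<in> U \<and> {x \<in> carrier G. F x = 0} \<inter> U \<in> null_sets \<mu>"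
      by blast
  qed
  then show "\<exists>N\<in>sets \<mu>. {x \<in> carrier G. F x = 0} \<subseteq> N \<and> emeasure \<mu> N = 0"
    by blast
qed

section \<open>Quaternions\<close>

lemma mk_quat_nth [simp]:
  "mk_quat a b c d $ 1 = a" "mk_quat a b c d $ 2 = b"
  "mk_quat a b c d $ 3 = c" "mk_quat a b c d $ 4 = d"
  by (simp_all add: mk_quat_def)

lemma quat_eq_iff:
  "p = q \<longleftrightarrow> p $ 1 = q $ 1 \<and> p $ 2 = q $ 2 \<and> p $ 3 = q $ 3 \<and> p $ 4 = q $ 4" for p q :: quat
  by (simp add: vec_eq_iff forall_4)

interpretation qmul: bounded_bilinear qmul
  unfolding bilinear_conv_bounded_bilinear [symmetric] bilinear_def
  by (auto intro!: linearI simp: quat_eq_iff qmul_def algebra_simps)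

lemmas qmul_zero [simp] = qmul.zero_left qmul.zero_right

lemma linear_qconj: "linear qconj"
  by (auto intro!: linearI simp: quat_eq_iff qconj_def algebra_simps)

lemmas qconj_sum = linear_sum[OF linear_qconj]
  and qconj_add = linear_add[OF linear_qconj]
  and qconj_zero [simp] = linear_0[OF linear_qconj]
  and qconj_scaleR = linear_scale[OF linear_qconj]

lemma qmul_assoc: "qmul (qmul p q) r = qmul p (qmul q r)"
  by (simp add: quat_eq_iff qmul_def algebra_simps)

lemma qmul_qone [simp]: "qmul qone q = q" "qmul q qone = q"
  by (simp_all add: quat_eq_iff qmul_def qone_def)

lemma qone_neq_0 [simp]: "qone \<noteq> 0"
  by (simp add: quat_eq_iff qone_def)

lemma qconj_qmul: "qconj (qmul p q) = qmul (qconj q) (qconj p)"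
  by (simp add: quat_eq_iff qmul_def qconj_def algebra_simps)

lemma qconj_qconj [simp]: "qconj (qconj q) = q"
  by (simp add: quat_eq_iff qconj_def)

lemma qconj_qone [simp]: "qconj qone = qone"
  by (simp add: quat_eq_iff qconj_def qone_def)

lemma qconj_nth_1 [simp]: "qconj q $ 1 = q $ 1"
  by (simp add: qconj_def)

lemma qconj_eq_0_iff [simp]: "qconj q = 0 \<longleftrightarrow> q = 0"
  by (metis qconj_qconj qconj_zero)

lemma qconj_eq_uminus_iff: "qconj p = - p \<longleftrightarrow> p $ 1 = 0"
  by (auto simp: quat_eq_iff qconj_def)

lemma Re_qmul_commute: "qmul p q $ 1 = qmul q p $ 1"
  by (simp add: qmul_def)

lemma qmul_qconj_left: "qmul (qconj q) q = (norm q)\<^sup>2 *\<^sub>R qone"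
  and qmul_qconj_right: "qmul q (qconj q) = (norm q)\<^sup>2 *\<^sub>R qone"
  by (simp_all add: quat_eq_iff qmul_def qconj_def qone_def power2_norm_eq_inner inner_vec_def
      sum_4 algebra_simps)

definition qinv :: "quat \<Rightarrow> quat" where
  "qinv q = (1 / (norm q)\<^sup>2) *\<^sub>R qconj q"

lemma qmul_qinv [simp]: "q \<noteq> 0 \<Longrightarrow> qmul q (qinv q) = qone" "q \<noteq> 0 \<Longrightarrow> qmul (qinv q) q = qone"
  by (simp_all add: qinv_def qmul.scaleR_right qmul.scaleR_left qmul_qconj_left qmul_qconj_right)

lemma qmul_eq_0_iff [simp]: "qmul p q = 0 \<longleftrightarrow> p = 0 \<or> q = 0"
  by (metis (full_types) qmul_zero qmul_assoc qmul_qinv(1) qmul_qone(2))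

lemma qmul_right_cancel: "r \<noteq> 0 \<Longrightarrow> qmul p r = qmul q r \<longleftrightarrow> p = q"
  by (metis qmul_assoc qmul_qinv(1) qmul_qone(2))

lemma qmul_mk_quat [simp]: "qmul (mk_quat a b c d) (mk_quat a' b' c' d') = mk_quat
     (a * a' - b * b' - c * c' - d * d') (a * b' + b * a' + c * d' - d * c')
     (a * c' - b * d' + c * a' + d * b') (a * d' + b * c' - c * b' + d * a')"
  by (simp add: qmul_def)

lemma qconj_mk_quat [simp]: "qconj (mk_quat a b c d) = mk_quat a (- b) (- c) (- d)"
  by (simp add: qconj_def)

lemma add_mk_quat [simp]:
  "mk_quat a b c d + mk_quat a' b' c' d' = mk_quat (a + a') (b + b') (c + c') (d + d')"
  by (simp add: quat_eq_iff)

lemma mk_quat_eq_0_iff [simp]: "mk_quat a b c d = 0 \<longleftrightarrow> a = 0 \<and> b = 0 \<and> c = 0 \<and> d = 0"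
  by (simp add: quat_eq_iff)

lemma ex_orthogonal_imaginary:
  obtains s where "s \<noteq> 0" "s $ 1 = 0" "qmul s m $ 1 = 0"
proof
  let ?s = "if m $ 3 = 0 \<and> m $ 4 = 0 then mk_quat 0 0 1 0 else mk_quat 0 0 (m $ 4) (- m $ 3)"
  show "?s \<noteq> 0" "?s $ 1 = 0" "qmul ?s m $ 1 = 0"
    by (auto simp: qmul_def)
qed

text \<open>If s and s q\<inverse> c are imaginary, then so are p = c s q\<inverse> and r = s\<inverse>.\<close>

lemma imaginary_factors:
  assumes "q \<noteq> 0"
  obtains p r where "p $ 1 = 0" "r $ 1 = 0" "qmul p (qmul q r) = c"
proof -
  obtain s where s: "s \<noteq> 0" "s $ 1 = 0" "qmul s (qmul (qinv q) c) $ 1 = 0"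
    using ex_orthogonal_imaginary .
  have "qmul (qmul c s) (qinv q) $ 1 = 0"
    using s(3) by (metis Re_qmul_commute qmul_assoc)
  moreover have "qinv s $ 1 = 0"
    using s(2) by (simp add: qinv_def)
  moreover have "qmul (qmul (qmul c s) (qinv q)) (qmul q (qinv s)) = c"
  proof -
    have "qmul (qmul (qmul c s) (qinv q)) (qmul q (qinv s))
        = qmul c (qmul s (qmul (qmul (qinv q) q) (qinv s)))"
      by (simp only: qmul_assoc)
    then show ?thesis
      using assms s(1) by simp
  qed
  ultimately show thesis
    by (rule that)
qed

lemma sum_with_pivot_eliminated:
  fixes a c x :: "'j \<Rightarrow> quat"
  assumes "finite J" "p \<in> J"
    and y: "y = x(p := - qmul (qinv (c p)) (\<Sum>j\<in>J - {p}. qmul (c j) (x j)))"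
  shows "(\<Sum>j\<in>J. qmul (a j) (y j))
    = (\<Sum>j\<in>J - {p}. qmul (a j - qmul (a p) (qmul (qinv (c p)) (c j))) (x j))"
proof -
  have "(\<Sum>j\<in>J. qmul (a j) (y j)) = qmul (a p) (y p) + (\<Sum>j\<in>J - {p}. qmul (a j) (y j))"
    using assms(1,2) by (simp add: sum.remove)
  also have "(\<Sum>j\<in>J - {p}. qmul (a j) (y j)) = (\<Sum>j\<in>J - {p}. qmul (a j) (x j))"
    by (rule sum.cong) (auto simp: y)
  finally show ?thesis
    by (simp add: y qmul.minus_right qmul.diff_left qmul.sum_right sum_subtractf qmul_assoc)
qed

lemma underdetermined_system_has_nonzero_solution:
  fixes a :: "'i \<Rightarrow> 'j \<Rightarrow> quat"
  assumes "finite I" "finite J" "card I < card J"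
  shows "\<exists>x. (\<exists>j\<in>J. x j \<noteq> 0) \<and> (\<forall>i\<in>I. (\<Sum>j\<in>J. qmul (a i j) (x j)) = 0)"
  using assms
proof (induction I arbitrary: a J rule: finite_induct)
  case empty
  then have "J \<noteq> {}"
    by auto
  then show ?case
    by (intro exI[of _ "\<lambda>_. qone"]) auto
next
  case (insert r I)
  show ?case
  proof (cases "\<forall>j\<in>J. a r j = 0")
    case True
    moreover obtain x where "\<exists>j\<in>J. x j \<noteq> 0" "\<forall>i\<in>I. (\<Sum>j\<in>J. qmul (a i j) (x j)) = 0"
      using insert.IH[of J a] insert.prems insert.hyps by auto
    ultimately show ?thesis
      by (intro exI[of _ x]) simp
  next
    case False
    then obtain p where p: "p \<in> J" "a r p \<noteq> 0"
      by blast
    define b where "b i j = a i j - qmul (a i p) (qmul (qinv (a r p)) (a r j))" for i j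
    have "card I < card (J - {p})"
      using insert p(1) by simp
    then obtain x where x: "\<exists>j\<in>J - {p}. x j \<noteq> 0"
      "\<forall>i\<in>I. (\<Sum>j\<in>J - {p}. qmul (b i j) (x j)) = 0"
      using insert.IH[of "J - {p}" b] insert.prems by auto
    define y where "y = x(p := - qmul (qinv (a r p)) (\<Sum>j\<in>J - {p}. qmul (a r j) (x j)))"
    have "(\<Sum>j\<in>J. qmul (a i j) (y j)) = (\<Sum>j\<in>J - {p}. qmul (b i j) (x j))" for i
      unfolding b_def using insert.prems(1) p(1) y_def by (rule sum_with_pivot_eliminated)
    moreover have "b r j = 0" for j
      using p(2) by (simp add: b_def flip: qmul_assoc)
    moreover have "\<exists>j\<in>J. y j \<noteq> 0"
      using x(1) by (auto simp: y_def)
    ultimately show ?thesis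
      using x(2) by (intro exI[of _ y]) simp
  qed
qed

section \<open>Quaternionic matrices and the Hermitian form\<close>

definition idx :: "nat \<Rightarrow> nat set" where
  "idx n = {1..n+1}"

lemma finite_idx [simp]: "finite (idx n)"
  and card_idx [simp]: "card (idx n) = n + 1"
  and zero_notin_idx [simp]: "0 \<notin> idx n"
  and first_in_idx [simp]: "1 \<in> idx n" "Suc 0 \<in> idx n"
  and last_in_idx [simp]: "n + 1 \<in> idx n" "Suc n \<in> idx n"
  by (simp_all add: idx_def)

text \<open>The Gram matrix of the form is the permutation matrix of this transposition.\<close>

definition swap_ends :: "nat \<Rightarrow> nat \<Rightarrow> nat" where
  "swap_ends n = Transposition.transpose 1 (n + 1)"

lemma swap_ends_swap_ends [simp]: "swap_ends n (swap_ends n k) = k"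
  by (simp add: swap_ends_def)

lemma swap_ends_eq_iff [simp]: "swap_ends n i = swap_ends n j \<longleftrightarrow> i = j"
  by (metis swap_ends_swap_ends)

lemma swap_ends_permutes: "swap_ends n permutes idx n"
  unfolding swap_ends_def by (rule permutes_swap_id) simp_all

lemma swap_ends_in_idx [simp]: "swap_ends n k \<in> idx n \<longleftrightarrow> k \<in> idx n"
  by (rule permutes_in_image[OF swap_ends_permutes])

lemma sum_swap_ends: "(\<Sum>k\<in>idx n. g (swap_ends n k)) = sum g (idx n)"
  using sum.permute[OF swap_ends_permutes, of g n] by (simp add: comp_def)

lemma hform_eq_sum:
  assumes "n \<ge> 1"
  shows "hform n z w = (\<Sum>k\<in>idx n. qmul (qconj (w (swap_ends n k))) (z k))"
proof -
  have "idx n = insert 1 (insert (n+1) {2..n})"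
    using assms by (auto simp: idx_def)
  moreover have "(\<Sum>k\<in>{2..n}. qmul (qconj (w (swap_ends n k))) (z k))
      = (\<Sum>k\<in>{2..n}. qmul (qconj (w k)) (z k))"
    by (rule sum.cong) (auto simp: swap_ends_def)
  ultimately show ?thesis
    using assms by (simp add: hform_def swap_ends_def)
qed

lemma qconj_hform: "n \<ge> 1 \<Longrightarrow> qconj (hform n z w) = hform n w z"
  by (simp add: hform_def qconj_add qconj_sum qconj_qmul)

lemma hform_cong:
  assumes "n \<ge> 1" "\<And>k. k \<in> idx n \<Longrightarrow> z k = z' k" "\<And>k. k \<in> idx n \<Longrightarrow> w k = w' k"
  shows "hform n z w = hform n z' w'"
  unfolding hform_eq_sum[OF assms(1)] by (rule sum.cong) (simp_all add: assms(2,3))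

definition unit_qvec :: "nat \<Rightarrow> qvec" where
  "unit_qvec j = (\<lambda>k. if k = j then qone else 0)"

lemma hform_unit_qvec:
  assumes "n \<ge> 1" "j \<in> idx n"
  shows "hform n (unit_qvec j) w = qconj (w (swap_ends n j))"
proof -
  have "hform n (unit_qvec j) w = (\<Sum>k\<in>idx n. if k = j then qconj (w (swap_ends n k)) else 0)"
    unfolding hform_eq_sum[OF assms(1)] by (rule sum.cong) (auto simp: unit_qvec_def)
  then show ?thesis
    using assms by simp
qed

lemma isotropic_eq_0_if_ends_eq_0:
  assumes "n \<ge> 1" "hform n v v = 0" "v 1 = 0" "v (n + 1) = 0" "k \<in> idx n"
  shows "v k = 0"
proof -
  have "hform n v v = (\<Sum>i\<in>{2..n}. (norm (v i))\<^sup>2) *\<^sub>R qone"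
    using assms(3,4) by (simp add: hform_def qmul_qconj_left scaleR_sum_left)
  then have "(\<Sum>i\<in>{2..n}. (norm (v i))\<^sup>2) = 0"
    using assms(2) by simp
  then have "\<forall>i\<in>{2..n}. v i = 0"
    by (simp add: sum_nonneg_eq_0_iff)
  then show ?thesis
    using assms(3-5) by (cases "k = 1 \<or> k = n + 1") (auto simp: idx_def)
qed

definition supported :: "nat \<Rightarrow> qmat \<Rightarrow> bool" where
  "supported n A \<longleftrightarrow> (\<forall>i j. \<not> (i \<in> idx n \<and> j \<in> idx n) \<longrightarrow> A i j = 0)"

lemma supported_eqI:
  assumes "supported n A" "supported n B"
    and "\<And>i j. i \<in> idx n \<Longrightarrow> j \<in> idx n \<Longrightarrow> A i j = B i j"
  shows "A = B"
  using assms unfolding supported_def by (intro ext) metis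

definition scale_qmat :: "real \<Rightarrow> qmat \<Rightarrow> qmat" where
  "scale_qmat s A = (\<lambda>i j. s *\<^sub>R A i j)"


lemma scale_qmat_nth: "scale_qmat s A i j = s *\<^sub>R A i j"
  by (simp add: scale_qmat_def)

lemma scale_qmat_scale_qmat [simp]: "scale_qmat s (scale_qmat t A) = scale_qmat (s * t) A"
  by (simp add: scale_qmat_def)

lemma scale_qmat_0 [simp]: "scale_qmat 0 A = 0" "scale_qmat s 0 = 0"
  and scale_qmat_1 [simp]: "scale_qmat 1 A = A"
  and uminus_qmat_eq_scale_qmat: "- A = scale_qmat (-1) A"
  and scale_qmat_add_right: "scale_qmat s (A + B) = scale_qmat s A + scale_qmat s B"
  by (simp_all add: scale_qmat_nth fun_eq_iff scaleR_add_right)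

lemma supported_scale_qmat [simp]: "supported n A \<Longrightarrow> supported n (scale_qmat s A)"
  and supported_add [simp]: "supported n A \<Longrightarrow> supported n B \<Longrightarrow> supported n (A + B)"
  by (simp_all add: supported_def scale_qmat_nth)

lemma supported_qmat_mult [simp]: "supported n (qmat_mult n A B)"
  by (simp add: supported_def qmat_mult_def idx_def)

lemma supported_qmat_id [simp]: "supported n (qmat_id n)"
  by (auto simp: supported_def qmat_id_def idx_def)

lemma qmat_apply_eq_sum: "qmat_apply n A z i = (\<Sum>k\<in>idx n. qmul (A i k) (z k))"
  by (simp add: qmat_apply_def idx_def)

lemma qmat_mult_nth:
  "i \<in> idx n \<Longrightarrow> j \<in> idx n \<Longrightarrow> qmat_mult n A B i j = (\<Sum>k\<in>idx n. qmul (A i k) (B k j))"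
  by (simp add: qmat_mult_def idx_def)

lemma qmat_mult_eq_qmat_apply:
  "qmat_mult n A B i j = (if i \<in> idx n \<and> j \<in> idx n then qmat_apply n A (\<lambda>k. B k j) i else 0)"
  by (simp add: qmat_mult_def qmat_apply_def idx_def)

lemma qmat_id_nth: "i \<in> idx n \<Longrightarrow> j \<in> idx n \<Longrightarrow> qmat_id n i j = (if i = j then qone else 0)"
  by (auto simp: qmat_id_def idx_def)

lemma qmat_apply_cong:
  "(\<And>k. k \<in> idx n \<Longrightarrow> z k = z' k) \<Longrightarrow> qmat_apply n A z i = qmat_apply n A z' i"
  unfolding qmat_apply_eq_sum by (rule sum.cong) simp_all

lemma qmat_apply_mult:
  assumes "i \<in> idx n"
  shows "qmat_apply n (qmat_mult n A B) z i = qmat_apply n A (qmat_apply n B z) i"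
proof -
  have "qmat_apply n (qmat_mult n A B) z i
      = (\<Sum>k\<in>idx n. \<Sum>l\<in>idx n. qmul (A i l) (qmul (B l k) (z k)))"
    unfolding qmat_apply_eq_sum
    by (rule sum.cong) (simp_all add: qmat_mult_nth[OF assms] qmul.sum_left qmul_assoc)
  also have "\<dots> = (\<Sum>l\<in>idx n. \<Sum>k\<in>idx n. qmul (A i l) (qmul (B l k) (z k)))"
    by (rule sum.swap)
  also have "\<dots> = qmat_apply n A (qmat_apply n B z) i"
    by (simp add: qmat_apply_eq_sum qmul.sum_right)
  finally show ?thesis .
qed

lemma qmat_apply_unit_qvec:
  assumes "j \<in> idx n"
  shows "qmat_apply n A (unit_qvec j) i = A i j"
proof -
  have "qmat_apply n A (unit_qvec j) i = (\<Sum>k\<in>idx n. if k = j then A i k else 0)"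
    unfolding qmat_apply_eq_sum by (rule sum.cong) (auto simp: unit_qvec_def)
  then show ?thesis
    using assms by simp
qed

lemma qmat_apply_id:
  assumes "i \<in> idx n"
  shows "qmat_apply n (qmat_id n) z i = z i"
proof -
  have "qmat_apply n (qmat_id n) z i = (\<Sum>k\<in>idx n. if k = i then z k else 0)"
    unfolding qmat_apply_eq_sum using assms by (intro sum.cong) (auto simp: qmat_id_nth)
  then show ?thesis
    using assms by simp
qed

lemma qmat_mult_assoc: "qmat_mult n (qmat_mult n A B) C = qmat_mult n A (qmat_mult n B C)"
proof (rule supported_eqI[where n = n])
  fix i j assume ij: "i \<in> idx n" "j \<in> idx n"
  then show "qmat_mult n (qmat_mult n A B) C i j = qmat_mult n A (qmat_mult n B C) i j"
    by (auto simp: qmat_mult_eq_qmat_apply[of n "qmat_mult n A B"] qmat_mult_eq_qmat_apply[of n A]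
        qmat_apply_mult qmat_mult_eq_qmat_apply[of n B] intro: qmat_apply_cong)
qed simp_all

lemma qmat_mult_id_left [simp]: "supported n A \<Longrightarrow> qmat_mult n (qmat_id n) A = A"
  by (rule supported_eqI[where n = n]) (simp_all add: qmat_mult_eq_qmat_apply qmat_apply_id)

lemma qmat_mult_id_right [simp]:
  assumes "supported n A"
  shows "qmat_mult n A (qmat_id n) = A"
proof (rule supported_eqI[where n = n])
  fix i j assume ij: "i \<in> idx n" "j \<in> idx n"
  then have "qmat_mult n A (qmat_id n) i j = qmat_apply n A (unit_qvec j) i"
    by (auto simp: qmat_mult_eq_qmat_apply qmat_id_nth unit_qvec_def intro: qmat_apply_cong)
  then show "qmat_mult n A (qmat_id n) i j = A i j"
    using ij by (simp add: qmat_apply_unit_qvec)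
qed (use assms in simp_all)

lemma qmat_mult_scale_left: "qmat_mult n (scale_qmat s A) B = scale_qmat s (qmat_mult n A B)"
  and qmat_mult_scale_right: "qmat_mult n A (scale_qmat s B) = scale_qmat s (qmat_mult n A B)"
  and qmat_mult_add_left: "qmat_mult n (A + A') B = qmat_mult n A B + qmat_mult n A' B"
  and qmat_mult_add_right: "qmat_mult n A (B + B') = qmat_mult n A B + qmat_mult n A B'"
  by (rule supported_eqI[where n = n];
      simp add: qmat_mult_nth scale_qmat_nth qmul.scaleR_left qmul.scaleR_right qmul.add_left
        qmul.add_right scaleR_sum_right sum.distrib)+

lemma qmat_left_inverse_imp_right_inverse:
  assumes BA: "qmat_mult n B A = qmat_id n"
  shows "qmat_mult n A B = qmat_id n"
proof (rule supported_eqI[where n = n])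
  fix i j assume ij: "i \<in> idx n" "j \<in> idx n"
  define a where "a i k = (if k = 0 then unit_qvec j i else A i k)" for i k
  obtain x where "\<exists>k\<in>insert 0 (idx n). x k \<noteq> 0"
    and x: "\<forall>i\<in>idx n. (\<Sum>k\<in>insert 0 (idx n). qmul (a i k) (x k)) = 0"
    using underdetermined_system_has_nonzero_solution[of "idx n" "insert 0 (idx n)" a] by auto
  have "(\<Sum>k\<in>idx n. qmul (a i k) (x k)) = qmat_apply n A x i" for i
    unfolding qmat_apply_eq_sum by (rule sum.cong) (auto simp: a_def)
  with x have Ax: "qmat_apply n A x i = - qmul (unit_qvec j i) (x 0)" if "i \<in> idx n" for i
    using that by (simp add: a_def eq_neg_iff_add_eq_0 add.commute)
  have x_eq: "x k = - qmul (B k j) (x 0)" if "k \<in> idx n" for k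
  proof -
    have "x k = qmat_apply n B (qmat_apply n A x) k"
      using that BA by (metis qmat_apply_id qmat_apply_mult)
    also have "\<dots> = qmat_apply n B (\<lambda>i. - qmul (unit_qvec j i) (x 0)) k"
      by (rule qmat_apply_cong) (rule Ax)
    also have "\<dots> = - qmul (qmat_apply n B (unit_qvec j) k) (x 0)"
      by (simp add: qmat_apply_eq_sum qmul.minus_right qmul.sum_left sum_negf qmul_assoc)
    finally show ?thesis
      using ij(2) by (simp add: qmat_apply_unit_qvec)
  qed
  then have "x 0 \<noteq> 0"
    using \<open>\<exists>k\<in>insert 0 (idx n). x k \<noteq> 0\<close> by auto
  moreover have "qmul (qmat_mult n A B i j) (x 0) = qmul (unit_qvec j i) (x 0)"
  proof -
    have "qmul (qmat_mult n A B i j) (x 0) = - qmat_apply n A (\<lambda>k. - qmul (B k j) (x 0)) i"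
      using ij by (simp add: qmat_mult_nth qmat_apply_eq_sum qmul.sum_left qmul.minus_right sum_negf
          qmul_assoc)
    also have "qmat_apply n A (\<lambda>k. - qmul (B k j) (x 0)) i = qmat_apply n A x i"
      by (rule qmat_apply_cong) (simp add: x_eq)
    finally show ?thesis
      using Ax[OF ij(1)] by simp
  qed
  ultimately show "qmat_mult n A B i j = qmat_id n i j"
    using ij by (simp add: qmul_right_cancel qmat_id_nth unit_qvec_def)
qed simp_all

definition qadj :: "nat \<Rightarrow> qmat \<Rightarrow> qmat" where
  "qadj n A = (\<lambda>i j. if i \<in> idx n \<and> j \<in> idx n
                      then qconj (A (swap_ends n j) (swap_ends n i)) else 0)"

lemma supported_qadj [simp]: "supported n (qadj n A)"
  by (auto simp: supported_def qadj_def)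

lemma qadj_nth:
  "i \<in> idx n \<Longrightarrow> j \<in> idx n \<Longrightarrow> qadj n A i j = qconj (A (swap_ends n j) (swap_ends n i))"
  by (simp add: qadj_def)

lemma qadj_qadj [simp]: "supported n A \<Longrightarrow> qadj n (qadj n A) = A"
  by (rule supported_eqI[where n = n]) (simp_all add: qadj_nth)

lemma qadj_mult: "qadj n (qmat_mult n A B) = qmat_mult n (qadj n B) (qadj n A)"
proof (rule supported_eqI[where n = n])
  fix i j assume ij: "i \<in> idx n" "j \<in> idx n"
  let ?i = "swap_ends n i" and ?j = "swap_ends n j"
  have "qadj n (qmat_mult n A B) i j = (\<Sum>k\<in>idx n. qmul (qconj (B k ?i)) (qconj (A ?j k)))"
    using ij by (simp add: qadj_nth qmat_mult_nth qconj_sum qconj_qmul)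
  also have "\<dots> = (\<Sum>k\<in>idx n. qmul (qconj (B (swap_ends n k) ?i)) (qconj (A ?j (swap_ends n k))))"
    by (rule sum_swap_ends[symmetric])
  also have "\<dots> = qmat_mult n (qadj n B) (qadj n A) i j"
    using ij by (simp add: qmat_mult_nth qadj_nth)
  finally show "qadj n (qmat_mult n A B) i j = qmat_mult n (qadj n B) (qadj n A) i j" .
qed simp_all

lemma qadj_id [simp]: "qadj n (qmat_id n) = qmat_id n"
  by (rule supported_eqI[where n = n]) (auto simp: qadj_nth qmat_id_nth)

lemma qadj_scale: "qadj n (scale_qmat s A) = scale_qmat s (qadj n A)"
  and qadj_add: "qadj n (A + B) = qadj n A + qadj n B"
  by (rule supported_eqI[where n = n]; simp add: qadj_nth scale_qmat_nth qconj_scaleR qconj_add)+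

lemma hform_qmat_apply_left:
  assumes "n \<ge> 1"
  shows "hform n (qmat_apply n A z) w = hform n z (qmat_apply n (qadj n A) w)"
proof -
  have "hform n (qmat_apply n A z) w
      = (\<Sum>k\<in>idx n. \<Sum>l\<in>idx n. qmul (qconj (w (swap_ends n k))) (qmul (A k l) (z l)))"
    by (simp add: hform_eq_sum[OF assms] qmat_apply_eq_sum qmul.sum_right)
  also have "\<dots> = (\<Sum>l\<in>idx n. \<Sum>k\<in>idx n. qmul (qconj (w (swap_ends n k))) (qmul (A k l) (z l)))"
    by (rule sum.swap)
  also have "\<dots> = (\<Sum>l\<in>idx n. \<Sum>k\<in>idx n. qmul (qconj (w k)) (qmul (A (swap_ends n k) l) (z l)))"
    using sum_swap_ends[of "\<lambda>k. qmul (qconj (w k)) (qmul (A (swap_ends n k) l) (z l))" n for l]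
    by simp
  also have "\<dots> = hform n z (qmat_apply n (qadj n A) w)"
    by (simp add: hform_eq_sum[OF assms] qmat_apply_eq_sum qadj_nth qconj_sum qconj_qmul
        qmul.sum_left qmul_assoc)
  finally show ?thesis .
qed

section \<open>The group Sp(n,1)\<close>

lemma Sp_iff:
  assumes n: "n \<ge> 1"
  shows "A \<in> Sp n \<longleftrightarrow> supported n A \<and> qmat_mult n (qadj n A) A = qmat_id n"
proof -
  have form: "hform n (qmat_apply n A z) (qmat_apply n A w)
      = hform n z (qmat_apply n (qmat_mult n (qadj n A) A) w)" for z w
    unfolding hform_qmat_apply_left[OF n] by (rule hform_cong[OF n]) (simp_all add: qmat_apply_mult)
  have "hform n (qmat_apply n A z) (qmat_apply n A w) = hform n z w"
    if "qmat_mult n (qadj n A) A = qmat_id n" for z w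
    unfolding form that by (rule hform_cong[OF n]) (simp_all add: qmat_apply_id)
  moreover have "qmat_mult n (qadj n A) A = qmat_id n"
    if "\<forall>z w. hform n (qmat_apply n A z) (qmat_apply n A w) = hform n z w"
  proof (rule supported_eqI[where n = n])
    fix i j assume ij: "i \<in> idx n" "j \<in> idx n"
    let ?z = "unit_qvec (swap_ends n i)" and ?w = "unit_qvec j"
    have "hform n ?z (qmat_apply n (qmat_mult n (qadj n A) A) ?w) = hform n ?z ?w"
      using that form by simp
    then have "qconj (qmat_mult n (qadj n A) A i j) = qconj (unit_qvec j i)"
      using ij n by (simp add: hform_unit_qvec qmat_apply_unit_qvec)
    then show "qmat_mult n (qadj n A) A i j = qmat_id n i j"
      using ij by (metis (full_types) qconj_qconj qmat_id_nth unit_qvec_def)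
  qed simp_all
  ultimately show ?thesis
    unfolding Sp_def supported_def idx_def by blast
qed

lemma supported_if_Sp: "A \<in> Sp n \<Longrightarrow> supported n A"
  by (simp add: Sp_def supported_def idx_def)

lemma Sp_preserves_hform:
  "A \<in> Sp n \<Longrightarrow> hform n (qmat_apply n A z) (qmat_apply n A w) = hform n z w"
  by (simp add: Sp_def)

lemma Sp_qadj_left_inverse: "n \<ge> 1 \<Longrightarrow> A \<in> Sp n \<Longrightarrow> qmat_mult n (qadj n A) A = qmat_id n"
  by (simp add: Sp_iff)

lemma Sp_qadj_cancel_left:
  "n \<ge> 1 \<Longrightarrow> A \<in> Sp n \<Longrightarrow> supported n B \<Longrightarrow> qmat_mult n (qadj n A) (qmat_mult n A B) = B"
  by (simp add: Sp_qadj_left_inverse flip: qmat_mult_assoc)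

lemma Sp_qadj_right_inverse: "n \<ge> 1 \<Longrightarrow> A \<in> Sp n \<Longrightarrow> qmat_mult n A (qadj n A) = qmat_id n"
  by (rule qmat_left_inverse_imp_right_inverse) (rule Sp_qadj_left_inverse)

lemma Sp_qadj: "n \<ge> 1 \<Longrightarrow> A \<in> Sp n \<Longrightarrow> qadj n A \<in> Sp n"
  by (simp add: Sp_iff[of n "qadj n A"] Sp_qadj_right_inverse supported_if_Sp)

lemma Sp_qmat_id: "n \<ge> 1 \<Longrightarrow> qmat_id n \<in> Sp n"
  by (simp add: Sp_iff)

lemma Sp_qmat_mult:
  assumes "n \<ge> 1" "A \<in> Sp n" "B \<in> Sp n"
  shows "qmat_mult n A B \<in> Sp n"
  using assms by (simp add: Sp_iff[OF assms(1), of "qmat_mult n A B"] qadj_mult qmat_mult_assoc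
      Sp_qadj_cancel_left supported_if_Sp Sp_qadj_left_inverse)

lemma Sp_uminus: "n \<ge> 1 \<Longrightarrow> A \<in> Sp n \<Longrightarrow> - A \<in> Sp n"
  by (simp add: uminus_qmat_eq_scale_qmat Sp_iff qadj_scale qmat_mult_scale_left
      qmat_mult_scale_right)

lemma Sp_apply_eq_0_imp_eq_0:
  assumes "n \<ge> 1" "A \<in> Sp n" "\<And>k. k \<in> idx n \<Longrightarrow> qmat_apply n A u k = 0" "j \<in> idx n"
  shows "u j = 0"
proof -
  have "u j = qmat_apply n (qadj n A) (qmat_apply n A u) j"
    using assms(1,2,4) by (metis Sp_qadj_left_inverse qmat_apply_id qmat_apply_mult)
  also have "\<dots> = 0"
    by (simp add: qmat_apply_eq_sum[of n "qadj n A"] assms(3))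
  finally show ?thesis .
qed

definition Sp_group :: "nat \<Rightarrow> qmat monoid" where
  "Sp_group n = \<lparr> carrier = Sp n, mult = qmat_mult n, one = qmat_id n \<rparr>"

lemma Sp_group_simps [simp]:
  "carrier (Sp_group n) = Sp n" "A \<otimes>\<^bsub>Sp_group n\<^esub> B = qmat_mult n A B" "\<one>\<^bsub>Sp_group n\<^esub> = qmat_id n"
  by (simp_all add: Sp_group_def)

lemma group_Sp_group:
  assumes "n \<ge> 1"
  shows "group (Sp_group n)"
proof (rule groupI)
  show "\<exists>B\<in>carrier (Sp_group n). B \<otimes>\<^bsub>Sp_group n\<^esub> A = \<one>\<^bsub>Sp_group n\<^esub>"
    if "A \<in> carrier (Sp_group n)" for A
    using that assms by (intro bexI[of _ "qadj n A"]) (simp_all add: Sp_qadj Sp_qadj_left_inverse)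
qed (use assms in \<open>simp_all add: Sp_qmat_id Sp_qmat_mult qmat_mult_assoc supported_if_Sp\<close>)

lemma inv_Sp_group:
  assumes "n \<ge> 1" "A \<in> Sp n"
  shows "inv\<^bsub>Sp_group n\<^esub> A = qadj n A"
  using assms group.inv_equality[OF group_Sp_group[OF assms(1)]]
  by (simp add: Sp_qadj Sp_qadj_left_inverse)

section \<open>The reversal defect\<close>

definition Re_trace :: "nat \<Rightarrow> qmat \<Rightarrow> real" where
  "Re_trace n A = (\<Sum>i\<in>idx n. A i i $ 1)"

lemma Re_trace_mult:
  "Re_trace n (qmat_mult n A B) = (\<Sum>i\<in>idx n. \<Sum>k\<in>idx n. qmul (A i k) (B k i) $ 1)"
  by (simp add: Re_trace_def qmat_mult_nth)

lemma Re_trace_mult_commute: "Re_trace n (qmat_mult n A B) = Re_trace n (qmat_mult n B A)"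
proof -
  have "Re_trace n (qmat_mult n A B) = (\<Sum>k\<in>idx n. \<Sum>i\<in>idx n. qmul (A i k) (B k i) $ 1)"
    unfolding Re_trace_mult by (rule sum.swap)
  also have "\<dots> = Re_trace n (qmat_mult n B A)"
    unfolding Re_trace_mult by (intro sum.cong refl Re_qmul_commute)
  finally show ?thesis .
qed

lemma Re_trace_qadj: "Re_trace n (qadj n A) = Re_trace n A"
  using sum_swap_ends[of "\<lambda>i. A i i $ 1" n] by (simp add: Re_trace_def qadj_nth)

lemma Re_trace_scale: "Re_trace n (scale_qmat s A) = s * Re_trace n A"
  by (simp add: Re_trace_def scale_qmat_nth sum_distrib_left)

definition qmat_conj :: "nat \<Rightarrow> qmat \<Rightarrow> qmat \<Rightarrow> qmat" where
  "qmat_conj n g A = qmat_mult n g (qmat_mult n A (qadj n g))"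

lemma qmat_conj_mult:
  assumes "n \<ge> 1" "g \<in> Sp n"
  shows "qmat_mult n (qmat_conj n g A) (qmat_conj n g B) = qmat_conj n g (qmat_mult n A B)"
  by (simp add: qmat_conj_def qmat_mult_assoc Sp_qadj_cancel_left[OF assms])

lemma qmat_conj_id: "n \<ge> 1 \<Longrightarrow> g \<in> Sp n \<Longrightarrow> qmat_conj n g (qmat_id n) = qmat_id n"
  by (simp add: qmat_conj_def Sp_qadj_right_inverse)

lemma Re_trace_conj:
  assumes "n \<ge> 1" "g \<in> Sp n" "supported n A"
  shows "Re_trace n (qmat_conj n g A) = Re_trace n A"
  using assms Re_trace_mult_commute[of n g "qmat_mult n A (qadj n g)"]
  by (simp add: qmat_conj_def qmat_mult_assoc Sp_qadj_left_inverse)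

primrec qmat_word :: "nat \<Rightarrow> qmat \<Rightarrow> qmat \<Rightarrow> bool list \<Rightarrow> qmat" where
  "qmat_word n a b [] = qmat_id n"
| "qmat_word n a b (x # w) = qmat_mult n (if x then a else b) (qmat_word n a b w)"

lemma supported_qmat_word [simp]: "supported n (qmat_word n a b w)"
  by (cases w) simp_all

lemma qmat_word_append:
  "qmat_word n a b (u @ w) = qmat_mult n (qmat_word n a b u) (qmat_word n a b w)"
  by (induction u) (simp_all add: qmat_mult_assoc)

lemma qadj_qmat_word:
  assumes "supported n a" "supported n b"
  shows "qadj n (qmat_word n a b w) = qmat_word n (qadj n a) (qadj n b) (rev w)"
  by (induction w) (simp_all add: qmat_word_append qadj_mult)

lemma qmat_word_scale: "qmat_word n (scale_qmat s a) (scale_qmat t b) w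
    = scale_qmat (s ^ count_list w True * t ^ count_list w False) (qmat_word n a b w)"
  by (induction w) (simp_all add: qmat_mult_scale_left qmat_mult_scale_right mult_ac)

lemma qmat_word_conj:
  assumes "n \<ge> 1" "g \<in> Sp n"
  shows "qmat_word n (qmat_conj n g a) (qmat_conj n g b) w = qmat_conj n g (qmat_word n a b w)"
  by (induction w) (simp_all add: qmat_conj_id[OF assms] qmat_conj_mult[OF assms])

definition reversal_word :: "bool list" where
  "reversal_word = [True, True, True, False, True, False, False, False]"

lemma count_list_reversal_word [simp]: "count_list reversal_word x = 4"
  by (cases x) (simp_all add: reversal_word_def)

definition reversal_defect :: "nat \<Rightarrow> qmat \<Rightarrow> qmat \<Rightarrow> real" where
  "reversal_defect n a b = Re_trace n (qmat_word n a b reversal_word)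
     - Re_trace n (qmat_word n a b (rev reversal_word))"

lemma reversal_defect_scale:
  "reversal_defect n (scale_qmat s a) (scale_qmat t b) = s ^ 4 * t ^ 4 * reversal_defect n a b"
  by (simp add: reversal_defect_def qmat_word_scale Re_trace_scale right_diff_distrib)

lemma reversal_defect_conj:
  assumes "n \<ge> 1" "g \<in> Sp n"
  shows "reversal_defect n (qmat_conj n g a) (qmat_conj n g b) = reversal_defect n a b"
  by (simp add: reversal_defect_def qmat_word_conj[OF assms] Re_trace_conj[OF assms])

lemma reversal_defect_qadj:
  assumes "supported n a" "supported n b"
  shows "reversal_defect n (qadj n a) (qadj n b) = - reversal_defect n a b"
proof -
  have "Re_trace n (qmat_word n (qadj n a) (qadj n b) w)
      = Re_trace n (qmat_word n a b (rev w))" for w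
    using qadj_qmat_word[OF assms, of "rev w"] Re_trace_qadj[of n "qmat_word n a b (rev w)"] by simp
  then show ?thesis
    by (simp add: reversal_defect_def)
qed

section \<open>Rank one matrices and transvections\<close>

text \<open>The linear map z \<mapsto> v c \<langle>z, u\<rangle>.\<close>

definition rank1 :: "nat \<Rightarrow> qvec \<Rightarrow> quat \<Rightarrow> qvec \<Rightarrow> qmat" where
  "rank1 n v c u = (\<lambda>i j. if i \<in> idx n \<and> j \<in> idx n
                          then qmul (v i) (qmul c (qconj (u (swap_ends n j)))) else 0)"

lemma rank1_nth: "i \<in> idx n \<Longrightarrow> j \<in> idx n \<Longrightarrow>
    rank1 n v c u i j = qmul (v i) (qmul c (qconj (u (swap_ends n j))))"
  by (simp add: rank1_def)

lemma supported_rank1 [simp]: "supported n (rank1 n v c u)"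
  by (auto simp: rank1_def supported_def)

lemma rank1_zero [simp]: "rank1 n v 0 u = 0"
  by (simp add: rank1_def fun_eq_iff)

lemma rank1_uminus: "rank1 n v (- c) u = scale_qmat (- 1) (rank1 n v c u)"
  by (simp add: rank1_def scale_qmat_nth fun_eq_iff qmul.minus_left qmul.minus_right)

lemma rank1_mult_rank1:
  assumes "n \<ge> 1"
  shows "qmat_mult n (rank1 n v c u) (rank1 n w d z) = rank1 n v (qmul c (qmul (hform n w u) d)) z"
  by (rule supported_eqI[where n = n])
    (simp_all add: qmat_mult_nth rank1_nth hform_eq_sum[OF assms] qmul.sum_left qmul.sum_right
      qmul_assoc)

lemma qadj_rank1: "qadj n (rank1 n v c u) = rank1 n u (qconj c) v"
  by (rule supported_eqI[where n = n]) (simp_all add: qadj_nth rank1_nth qconj_qmul qmul_assoc)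

lemma rank1_mult_Sp:
  assumes n: "n \<ge> 1" and A: "A \<in> Sp n"
  shows "qmat_mult n (rank1 n v c (qmat_apply n A u)) A = rank1 n v c u"
proof (rule supported_eqI[where n = n])
  fix i j assume ij: "i \<in> idx n" "j \<in> idx n"
  have "qmat_mult n (rank1 n v c (qmat_apply n A u)) A i j
      = qmul (v i) (qmul c (hform n (qmat_apply n A (unit_qvec j)) (qmat_apply n A u)))"
    using ij by (simp add: qmat_mult_nth rank1_nth hform_eq_sum[OF n] qmat_apply_unit_qvec
        qmul.sum_right qmul_assoc)
  also have "\<dots> = rank1 n v c u i j"
    using ij by (simp add: Sp_preserves_hform[OF A] hform_unit_qvec[OF n] rank1_nth)
  finally show "qmat_mult n (rank1 n v c (qmat_apply n A u)) A i j = rank1 n v c u i j" .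
qed simp_all

lemma Re_trace_rank1:
  assumes "n \<ge> 1"
  shows "Re_trace n (rank1 n v c u) = qmul c (hform n v u) $ 1"
proof -
  have "Re_trace n (rank1 n v c u)
      = (\<Sum>i\<in>idx n. qmul c (qmul (qconj (u (swap_ends n i))) (v i)) $ 1)"
    unfolding Re_trace_def
    by (intro sum.cong refl) (simp add: rank1_nth Re_qmul_commute[of "v _"] qmul_assoc)
  then show ?thesis
    by (simp add: hform_eq_sum[OF assms] qmul.sum_right)
qed

text \<open>The transvections are the case s = 1.  Homogenising in s turns the limit t \<rightarrow> \<infinity> into the
  evaluation at s = 0.\<close>

definition transvection :: "nat \<Rightarrow> qvec \<Rightarrow> quat \<Rightarrow> real \<Rightarrow> real \<Rightarrow> qmat" where
  "transvection n v p s t = scale_qmat s (qmat_id n) + scale_qmat t (rank1 n v p v)"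

lemma supported_transvection [simp]: "supported n (transvection n v p s t)"
  by (simp add: transvection_def)

lemma transvection_0_1 [simp]: "transvection n v p 0 1 = rank1 n v p v"
  and transvection_1_0 [simp]: "transvection n v p 1 0 = qmat_id n"
  by (simp_all add: transvection_def)

lemma transvection_scale:
  "s \<noteq> 0 \<Longrightarrow> transvection n v p s 1 = scale_qmat s (transvection n v p 1 (1 / s))"
  by (simp add: transvection_def scale_qmat_add_right)

lemma qadj_transvection:
  assumes "p $ 1 = 0"
  shows "qadj n (transvection n v p s t) = transvection n v p s (- t)"
  using assms by (simp add: transvection_def qadj_add qadj_scale qadj_rank1 rank1_uminus
      flip: qconj_eq_uminus_iff)

lemma transvection_mult_inverse:
  assumes "n \<ge> 1" "hform n v v = 0"
  shows "qmat_mult n (transvection n v p 1 (- t)) (transvection n v p 1 t) = qmat_id n"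
proof -
  have "qmat_mult n (rank1 n v p v) (rank1 n v p v) = 0"
    using assms by (simp add: rank1_mult_rank1)
  then have "qmat_mult n (transvection n v p 1 (- t)) (transvection n v p 1 t)
      = qmat_id n + (scale_qmat t (rank1 n v p v) + scale_qmat (- t) (rank1 n v p v))"
    by (simp add: transvection_def qmat_mult_add_left qmat_mult_add_right qmat_mult_scale_left
        qmat_mult_scale_right scale_qmat_add_right add.assoc)
  then show ?thesis
    by (simp add: scale_qmat_nth fun_eq_iff)
qed

lemma Sp_transvection:
  assumes "n \<ge> 1" "hform n v v = 0" "p $ 1 = 0"
  shows "transvection n v p 1 t \<in> Sp n"
  using assms by (simp add: Sp_iff qadj_transvection transvection_mult_inverse)

definition isotropic :: "nat \<Rightarrow> qvec \<Rightarrow> bool" where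
  "isotropic n v \<longleftrightarrow> hform n v v = 0 \<and> (\<exists>k\<in>idx n. v k \<noteq> 0)"

lemma isotropic_ends_neq_0: "n \<ge> 1 \<Longrightarrow> isotropic n v \<Longrightarrow> v 1 \<noteq> 0 \<or> v (n + 1) \<noteq> 0"
  using isotropic_eq_0_if_ends_eq_0 unfolding isotropic_def by blast

lemma isotropic_Sp_apply:
  assumes "n \<ge> 1" "A \<in> Sp n" "isotropic n v"
  shows "isotropic n (qmat_apply n A v)"
  using assms Sp_apply_eq_0_imp_eq_0[OF assms(1,2), of v] Sp_preserves_hform[OF assms(2)]
  unfolding isotropic_def by metis

definition pair_vec :: "nat \<Rightarrow> quat \<Rightarrow> quat \<Rightarrow> qvec" where
  "pair_vec n x y = (\<lambda>k. if k = 1 then x else if k = n + 1 then y else 0)"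

lemma pair_vec_ends: "n \<ge> 1 \<Longrightarrow> pair_vec n x y 1 = x" "n \<ge> 1 \<Longrightarrow> pair_vec n x y (n + 1) = y"
  by (simp_all add: pair_vec_def)

lemma hform_pair_vec:
  assumes "n \<ge> 1"
  shows "hform n z (pair_vec n x y) = qmul (qconj y) (z 1) + qmul (qconj x) (z (n + 1))"
  using assms by (simp add: hform_def pair_vec_def sum.neutral)

lemma isotropic_pair_vec:
  assumes "n \<ge> 1" "qmul (qconj y) x + qmul (qconj x) y = 0" "x \<noteq> 0 \<or> y \<noteq> 0"
  shows "isotropic n (pair_vec n x y)"
  unfolding isotropic_def
proof
  show "hform n (pair_vec n x y) (pair_vec n x y) = 0"
    using assms(2) by (simp only: hform_pair_vec[OF assms(1)] pair_vec_ends[OF assms(1)])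
  show "\<exists>k\<in>idx n. pair_vec n x y k \<noteq> 0"
    using assms(3) pair_vec_ends[OF assms(1)] first_in_idx(1) last_in_idx(1) by metis
qed

lemma ex_isotropic_not_orthogonal:
  assumes n: "n \<ge> 1" and a: "isotropic n a" and b: "isotropic n b"
  obtains v where "isotropic n v" "hform n a v \<noteq> 0" "hform n b v \<noteq> 0"
proof -
  let ?i = "mk_quat 0 1 0 0"
  have isotropic: "isotropic n (pair_vec n qone 0)" "isotropic n (pair_vec n 0 qone)"
    "isotropic n (pair_vec n qone ?i)"
    by (intro isotropic_pair_vec[OF n]; simp add: qone_def)+
  have form: "hform n z (pair_vec n qone 0) = z (n + 1)" "hform n z (pair_vec n 0 qone) = z 1" for z
    by (simp_all add: hform_pair_vec[OF n])
  have mixed: "hform n z (pair_vec n qone ?i) \<noteq> 0" if "(z 1 = 0) \<noteq> (z (n + 1) = 0)" for z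
    using that by (auto simp: hform_pair_vec[OF n])
  consider "a (n + 1) \<noteq> 0" "b (n + 1) \<noteq> 0" | "a 1 \<noteq> 0" "b 1 \<noteq> 0"
    | "(a 1 = 0) \<noteq> (a (n + 1) = 0)" "(b 1 = 0) \<noteq> (b (n + 1) = 0)"
    using isotropic_ends_neq_0[OF n a] isotropic_ends_neq_0[OF n b] by blast
  then show thesis
    using that isotropic form mixed by cases metis+
qed

lemma rank1_eq_product_of_transvection_limits:
  assumes n: "n \<ge> 1" and y: "y \<in> Sp n" and v: "isotropic n v" and u: "isotropic n u"
  obtains v2 v3 p1 p2 p3 where "hform n v2 v2 = 0" "hform n v3 v3 = 0"
    "p1 $ 1 = 0" "p2 $ 1 = 0" "p3 $ 1 = 0"
    "qmat_mult n (qmat_mult n (rank1 n v p1 v)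
       (qmat_mult n (rank1 n v2 p2 v2) (rank1 n v3 p3 v3))) y = rank1 n v c u"
proof -
  define v3 where "v3 = qmat_apply n y u"
  have v3: "isotropic n v3"
    unfolding v3_def using n y u by (rule isotropic_Sp_apply)
  obtain v2 where v2: "isotropic n v2" "hform n v v2 \<noteq> 0" "hform n v3 v2 \<noteq> 0"
    using ex_isotropic_not_orthogonal[OF n v v3] .
  have "hform n v2 v \<noteq> 0"
    using v2(2) qconj_hform[OF n, of v v2] by auto
  define p2 where "p2 = mk_quat 0 1 0 0"
  define q where "q = qmul (hform n v2 v) (qmul p2 (hform n v3 v2))"
  have "q \<noteq> 0"
    using \<open>hform n v2 v \<noteq> 0\<close> v2(3) by (simp add: q_def p2_def)
  then obtain p1 p3 where p: "p1 $ 1 = 0" "p3 $ 1 = 0" "qmul p1 (qmul q p3) = c"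
    using imaginary_factors[of q c] by blast
  have "qmat_mult n (qmat_mult n (rank1 n v p1 v)
       (qmat_mult n (rank1 n v2 p2 v2) (rank1 n v3 p3 v3))) y = rank1 n v c u"
    using p(3) rank1_mult_Sp[OF n y, of v c u]
    by (simp add: rank1_mult_rank1[OF n] q_def qmul_assoc flip: v3_def)
  then show thesis
    using v2 v3 p by (intro that[of v2 v3 p1 p2 p3]) (simp_all add: isotropic_def p2_def)
qed

text \<open>Found by a search over small quaternions; the form takes the values 1, j, 1, k on the pairs
  of a range and a corange vector.\<close>

definition range_a :: "nat \<Rightarrow> qvec" where
  "range_a n = pair_vec n qone 0"

definition corange_a :: "nat \<Rightarrow> qvec" where
  "corange_a n = pair_vec n 0 qone"

definition range_b :: "nat \<Rightarrow> qvec" where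
  "range_b n = pair_vec n (mk_quat 0 0 1 0) qone"

definition corange_b :: "nat \<Rightarrow> qvec" where
  "corange_b n = pair_vec n (mk_quat 0 0 1 (-1)) qone"

definition witness_coeff :: quat where
  "witness_coeff = mk_quat 1 0 0 1"

lemma isotropic_witnesses:
  assumes "n \<ge> 1"
  shows "isotropic n (range_a n)" "isotropic n (corange_a n)"
    "isotropic n (range_b n)" "isotropic n (corange_b n)"
  unfolding range_a_def corange_a_def range_b_def corange_b_def
  by (intro isotropic_pair_vec[OF assms]; simp add: qone_def)+

lemma reversal_defect_witnesses:
  assumes n: "n \<ge> 1"
  shows "reversal_defect n (rank1 n (range_a n) witness_coeff (corange_a n))
    (rank1 n (range_b n) witness_coeff (corange_b n)) = - 32"
proof -
  have "hform n (range_a n) (corange_a n) = mk_quat 1 0 0 0"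
    "hform n (range_b n) (corange_a n) = mk_quat 0 0 1 0"
    "hform n (range_a n) (corange_b n) = mk_quat 1 0 0 0"
    "hform n (range_b n) (corange_b n) = mk_quat 0 0 0 1"
    unfolding range_a_def corange_a_def range_b_def corange_b_def
    by (simp_all only: hform_pair_vec[OF n] pair_vec_ends[OF n]) (simp_all add: qone_def)
  then show ?thesis
    by (simp add: reversal_defect_def reversal_word_def witness_coeff_def rank1_mult_rank1[OF n]
        Re_trace_rank1[OF n])
qed

section \<open>Polynomial curves leaving the zero set\<close>

lemma polynomial_function_bilinear:
  fixes f :: "'a::real_normed_vector \<Rightarrow> 'b::euclidean_space" and g :: "'a \<Rightarrow> 'c::euclidean_space"
    and h :: "'b \<Rightarrow> 'c \<Rightarrow> 'd::real_normed_vector"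
  assumes "bounded_bilinear h" and f: "polynomial_function f" and g: "polynomial_function g"
  shows "polynomial_function (\<lambda>x. h (f x) (g x))"
proof -
  interpret bounded_bilinear h by fact
  have expansion: "h (f x) (g x) = (\<Sum>j\<in>Basis. \<Sum>i\<in>Basis. (g x \<bullet> j) *\<^sub>R (f x \<bullet> i) *\<^sub>R h i j)" for x
  proof -
    have "h (f x) (g x) = h (\<Sum>i\<in>Basis. (f x \<bullet> i) *\<^sub>R i) (\<Sum>j\<in>Basis. (g x \<bullet> j) *\<^sub>R j)"
      by (simp add: euclidean_representation)
    also have "\<dots> = (\<Sum>j\<in>Basis. \<Sum>i\<in>Basis. (g x \<bullet> j) *\<^sub>R (f x \<bullet> i) *\<^sub>R h i j)"
      by (simp only: sum_left sum_right scaleR_left scaleR_right scaleR_sum_right)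
    finally show ?thesis .
  qed
  show ?thesis
    unfolding expansion
    by (intro polynomial_function_sum polynomial_function_mult polynomial_function_inner
        polynomial_function_const finite_Basis f g)
qed

definition qmat_polynomial :: "(real \<Rightarrow> qmat) \<Rightarrow> bool" where
  "qmat_polynomial M \<longleftrightarrow> (\<forall>i j. polynomial_function (\<lambda>t. M t i j))"

lemma qmat_polynomial_const: "qmat_polynomial (\<lambda>t. A)"
  by (simp add: qmat_polynomial_def)

lemma qmat_polynomial_transvection:
  assumes "polynomial_function f" "polynomial_function g"
  shows "qmat_polynomial (\<lambda>t. transvection n v p (f t) (g t))"
  using assms unfolding qmat_polynomial_def transvection_def scale_qmat_nth
  by (simp add: polynomial_function_add polynomial_function_mult)

lemma qmat_polynomial_mult:
  assumes "qmat_polynomial M" "qmat_polynomial N"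
  shows "qmat_polynomial (\<lambda>t. qmat_mult n (M t) (N t))"
  unfolding qmat_polynomial_def
proof (intro allI)
  fix i j
  show "polynomial_function (\<lambda>t. qmat_mult n (M t) (N t) i j)"
  proof (cases "i \<in> idx n \<and> j \<in> idx n")
    case True
    have "polynomial_function (\<lambda>t. \<Sum>k\<in>idx n. qmul (M t i k) (N t k j))"
      using assms unfolding qmat_polynomial_def
      by (intro polynomial_function_sum polynomial_function_bilinear[OF qmul.bounded_bilinear_axioms])
        simp_all
    with True show ?thesis
      by (simp add: qmat_mult_nth)
  next
    case False
    then show ?thesis
      by (auto simp: qmat_mult_eq_qmat_apply)
  qed
qed

lemma qmat_polynomial_word:
  assumes "qmat_polynomial a" "qmat_polynomial b"
  shows "qmat_polynomial (\<lambda>t. qmat_word n (a t) (b t) w)"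
proof (induction w)
  case Nil
  then show ?case
    by (simp add: qmat_polynomial_const)
next
  case (Cons x w)
  with assms show ?case
    by (cases x) (simp_all add: qmat_polynomial_mult)
qed

lemma real_polynomial_function_Re_trace:
  assumes "qmat_polynomial M"
  shows "real_polynomial_function (\<lambda>t. Re_trace n (M t))"
  unfolding Re_trace_def
proof (rule real_polynomial_function_sum)
  fix i
  have "real_polynomial_function ((\<lambda>q. q $ 1) \<circ> (\<lambda>t. M t i i))"
    using assms bounded_linear_vec_nth unfolding qmat_polynomial_def polynomial_function_def
    by blast
  then show "real_polynomial_function (\<lambda>t. M t i i $ 1)"
    by (simp add: comp_def)
qed simp

lemma real_polynomial_function_reversal_defect:
  assumes "qmat_polynomial a" "qmat_polynomial b"
  shows "real_polynomial_function (\<lambda>t. reversal_defect n (a t) (b t))"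
  unfolding reversal_defect_def
  by (intro real_polynomial_function_diff real_polynomial_function_Re_trace qmat_polynomial_word
      assms)

lemma ex_homogeneous_curve_to_rank1:
  assumes n: "n \<ge> 1" and y: "y \<in> Sp n" and v: "isotropic n v" and u: "isotropic n u"
  obtains Z where "\<And>t. Z 1 t \<in> Sp n" "Z 1 0 = qmat_id n"
    "qmat_polynomial (\<lambda>t. Z 1 t)" "qmat_polynomial (\<lambda>s. Z s 1)"
    "\<And>s. s \<noteq> 0 \<Longrightarrow> Z s 1 = scale_qmat (s ^ 3) (Z 1 (1 / s))"
    "qmat_mult n (Z 0 1) y = rank1 n v c u"
proof -
  obtain v2 v3 p1 p2 p3 where forms: "hform n v2 v2 = 0" "hform n v3 v3 = 0"
    and im: "p1 $ 1 = 0" "p2 $ 1 = 0" "p3 $ 1 = 0"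
    and limit: "qmat_mult n (qmat_mult n (rank1 n v p1 v)
       (qmat_mult n (rank1 n v2 p2 v2) (rank1 n v3 p3 v3))) y = rank1 n v c u"
    using rank1_eq_product_of_transvection_limits[OF assms, of c] .
  define Z where "Z s t = qmat_mult n (transvection n v p1 s t)
     (qmat_mult n (transvection n v2 p2 s t) (transvection n v3 p3 s t))" for s t
  show thesis
  proof
    show "Z 1 t \<in> Sp n" for t
      unfolding Z_def using n forms im v
      by (intro Sp_qmat_mult Sp_transvection) (simp_all add: isotropic_def)
    show "Z 1 0 = qmat_id n"
      by (simp add: Z_def)
    show "qmat_polynomial (\<lambda>t. Z 1 t)" "qmat_polynomial (\<lambda>s. Z s 1)"
      unfolding Z_def by (intro qmat_polynomial_mult qmat_polynomial_transvection; simp)+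
    show "Z s 1 = scale_qmat (s ^ 3) (Z 1 (1 / s))" if "s \<noteq> 0" for s
      using that by (simp add: Z_def transvection_scale qmat_mult_scale_left qmat_mult_scale_right
          power3_eq_cube)
    show "qmat_mult n (Z 0 1) y = rank1 n v c u"
      using limit by (simp add: Z_def)
  qed
qed

lemma ex_curves_reversal_defect_neq_0:
  assumes n: "n \<ge> 1" and y: "y1 \<in> Sp n" "y2 \<in> Sp n"
  obtains X1 X2 t where "\<And>t. X1 t \<in> Sp n" "\<And>t. X2 t \<in> Sp n" "X1 0 = qmat_id n" "X2 0 = qmat_id n"
    "qmat_polynomial X1" "qmat_polynomial X2"
    "reversal_defect n (qmat_mult n (X1 t) y1) (qmat_mult n (X2 t) y2) \<noteq> 0"
proof -
  obtain Z1 where Z1: "\<And>t. Z1 1 t \<in> Sp n" "Z1 1 0 = qmat_id n" "qmat_polynomial (\<lambda>t. Z1 1 t)"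
    and Z1_lim: "qmat_polynomial (\<lambda>s. Z1 s 1)"
      "\<And>s. s \<noteq> 0 \<Longrightarrow> Z1 s 1 = scale_qmat (s ^ 3) (Z1 1 (1 / s))"
      "qmat_mult n (Z1 0 1) y1 = rank1 n (range_a n) witness_coeff (corange_a n)"
    by (rule ex_homogeneous_curve_to_rank1[OF n y(1) isotropic_witnesses(1,2)[OF n],
          of witness_coeff]) blast
  obtain Z2 where Z2: "\<And>t. Z2 1 t \<in> Sp n" "Z2 1 0 = qmat_id n" "qmat_polynomial (\<lambda>t. Z2 1 t)"
    and Z2_lim: "qmat_polynomial (\<lambda>s. Z2 s 1)"
      "\<And>s. s \<noteq> 0 \<Longrightarrow> Z2 s 1 = scale_qmat (s ^ 3) (Z2 1 (1 / s))"
      "qmat_mult n (Z2 0 1) y2 = rank1 n (range_b n) witness_coeff (corange_b n)"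
    by (rule ex_homogeneous_curve_to_rank1[OF n y(2) isotropic_witnesses(3,4)[OF n],
          of witness_coeff]) blast
  define H where "H s = reversal_defect n (qmat_mult n (Z1 s 1) y1) (qmat_mult n (Z2 s 1) y2)" for s
  have "real_polynomial_function H"
    unfolding H_def using Z1_lim(1) Z2_lim(1)
    by (intro real_polynomial_function_reversal_defect qmat_polynomial_mult qmat_polynomial_const)
  moreover have "H 0 \<noteq> 0"
    using reversal_defect_witnesses[OF n] by (simp add: H_def Z1_lim(3) Z2_lim(3))
  ultimately have "finite (insert 0 {s. H s = 0})"
    by (simp add: finite_zeros_real_polynomial_function)
  then obtain s where s: "s \<noteq> 0" "H s \<noteq> 0"
    using ex_new_if_finite[OF infinite_UNIV_char_0] by blast
  have "H s = (s ^ 3) ^ 4 * (s ^ 3) ^ 4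
      * reversal_defect n (qmat_mult n (Z1 1 (1 / s)) y1) (qmat_mult n (Z2 1 (1 / s)) y2)"
    by (simp only: H_def Z1_lim(2)[OF s(1)] Z2_lim(2)[OF s(1)] qmat_mult_scale_left
        reversal_defect_scale)
  then have "reversal_defect n (qmat_mult n (Z1 1 (1 / s)) y1) (qmat_mult n (Z2 1 (1 / s)) y2) \<noteq> 0"
    using s(2) by auto
  then show thesis
    by (rule that[OF Z1(1) Z2(1) Z1(2) Z2(2) Z1(3) Z2(3)])
qed

section \<open>Topology of Sp(n,1)\<close>

lemma continuous_on_qmat_iff:
  fixes F :: "'a::topological_space \<Rightarrow> qmat"
  shows "continuous_on S F \<longleftrightarrow> (\<forall>i j. continuous_on S (\<lambda>x. F x i j))"
proof
  show "\<forall>i j. continuous_on S (\<lambda>x. F x i j)" if "continuous_on S F"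
    by (intro allI continuous_on_product_then_coordinatewise[OF
          continuous_on_product_then_coordinatewise[OF that]])
  show "continuous_on S F" if "\<forall>i j. continuous_on S (\<lambda>x. F x i j)"
    by (intro continuous_on_coordinatewise_then_product that[rule_format])
qed

lemma continuous_on_qmat_nth: "continuous_on S F \<Longrightarrow> continuous_on S (\<lambda>x. F x i j)"
  for F :: "'a::topological_space \<Rightarrow> qmat"
  by (simp add: continuous_on_qmat_iff)

lemma continuous_on_scale_qmat: "continuous_on S F \<Longrightarrow> continuous_on S (\<lambda>x. scale_qmat s (F x))"
  unfolding continuous_on_qmat_iff scale_qmat_nth by (simp add: continuous_on_scaleR)

lemma continuous_on_qmat_mult:
  assumes "continuous_on S F" "continuous_on S G"
  shows "continuous_on S (\<lambda>x. qmat_mult n (F x) (G x))"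
  unfolding continuous_on_qmat_iff
proof (intro allI)
  fix i j
  show "continuous_on S (\<lambda>x. qmat_mult n (F x) (G x) i j)"
  proof (cases "i \<in> idx n \<and> j \<in> idx n")
    case True
    have "continuous_on S (\<lambda>x. \<Sum>k\<in>idx n. qmul (F x i k) (G x k j))"
      using assms by (intro continuous_on_sum qmul.continuous_on continuous_on_qmat_nth)
    with True show ?thesis
      by (simp add: qmat_mult_nth)
  next
    case False
    then show ?thesis
      by (auto simp: qmat_mult_eq_qmat_apply)
  qed
qed

lemma continuous_on_qadj:
  assumes "continuous_on S F"
  shows "continuous_on S (\<lambda>x. qadj n (F x))"
  unfolding continuous_on_qmat_iff qadj_def
proof (intro allI)
  fix i j
  show "continuous_on S (\<lambda>x. if i \<in> idx n \<and> j \<in> idx n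
      then qconj (F x (swap_ends n j) (swap_ends n i)) else 0)"
    using bounded_linear.continuous_on[OF linear_qconj[unfolded linear_conv_bounded_linear]
        continuous_on_qmat_nth[OF assms]]
    by (cases "i \<in> idx n \<and> j \<in> idx n") auto
qed

lemma continuous_on_qmat_word:
  assumes "continuous_on S F" "continuous_on S G"
  shows "continuous_on S (\<lambda>x. qmat_word n (F x) (G x) w)"
proof (induction w)
  case (Cons x w)
  with assms show ?case
    by (cases x) (simp_all add: continuous_on_qmat_mult)
qed simp

lemma continuous_on_Re_trace:
  assumes "continuous_on S F"
  shows "continuous_on S (\<lambda>x. Re_trace n (F x))"
  unfolding Re_trace_def
  by (intro continuous_on_sum bounded_linear.continuous_on[OF bounded_linear_vec_nth]
      continuous_on_qmat_nth[OF assms])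

lemma continuous_on_reversal_defect:
  assumes "continuous_on S F" "continuous_on S G"
  shows "continuous_on S (\<lambda>x. reversal_defect n (F x) (G x))"
  unfolding reversal_defect_def
  by (intro continuous_on_diff continuous_on_Re_trace continuous_on_qmat_word assms)

lemma continuous_on_qmat_polynomial: "qmat_polynomial M \<Longrightarrow> continuous_on S M"
  by (simp add: qmat_polynomial_def continuous_on_qmat_iff continuous_on_polymonial_function)

lemma topspace_Sp_top [simp]: "topspace (Sp_top n) = Sp n"
  by (simp add: Sp_top_def)

lemma prod_Sp_top: "prod_topology (Sp_top n) (Sp_top n) = top_of_set (Sp n \<times> Sp n)"
  by (simp add: Sp_top_def flip: subtopology_Times)

lemma topological_group_Sp_group:
  assumes n: "n \<ge> 1"
  shows "topological_group (Sp_group n) (Sp_top n)"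
proof -
  interpret group "Sp_group n"
    by (rule group_Sp_group[OF n])
  show ?thesis
  proof
    have "continuous_on (Sp n \<times> Sp n) (\<lambda>p. qmat_mult n (fst p) (snd p))"
      by (intro continuous_on_qmat_mult continuous_on_fst continuous_on_snd continuous_on_id)
    then show "continuous_map (prod_topology (Sp_top n) (Sp_top n)) (Sp_top n)
        (\<lambda>(A, B). A \<otimes>\<^bsub>Sp_group n\<^esub> B)"
      using n unfolding prod_Sp_top case_prod_beta Sp_group_simps
      by (auto simp: Sp_top_def continuous_map_in_subtopology Sp_qmat_mult)
    have "continuous_on (Sp n) (qadj n)"
      using continuous_on_qadj[OF continuous_on_id] .
    then have "continuous_map (Sp_top n) (Sp_top n) (qadj n)"
      using n by (auto simp: Sp_top_def continuous_map_in_subtopology Sp_qadj)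
    then show "continuous_map (Sp_top n) (Sp_top n) (\<lambda>A. inv\<^bsub>Sp_group n\<^esub> A)"
      by (rule continuous_map_eq) (simp add: inv_Sp_group[OF n])
  qed simp
qed

lemma closed_Sp:
  assumes "n \<ge> 1"
  shows "closed (Sp n)"
proof -
  have "closed {A :: qmat. \<forall>i j. \<not> (i \<in> idx n \<and> j \<in> idx n) \<longrightarrow> A i j = 0}"
    by (intro closed_Collect_all closed_Collect_imp open_Collect_const closed_Collect_eq
        continuous_on_qmat_nth continuous_on_id continuous_on_const)
  moreover have "closed {A. qmat_mult n (qadj n A) A = qmat_id n}"
    by (intro closed_Collect_eq continuous_on_qmat_mult continuous_on_qadj continuous_on_id
        continuous_on_const)
  moreover have "Sp n = {A. \<forall>i j. \<not> (i \<in> idx n \<and> j \<in> idx n) \<longrightarrow> A i j = 0}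
      \<inter> {A. qmat_mult n (qadj n A) A = qmat_id n}"
    using Sp_iff[OF assms] unfolding supported_def by blast
  ultimately show ?thesis
    by (simp add: closed_Int)
qed

lemma compact_pointwise:
  assumes "compact S"
  shows "compact {f :: 'a \<Rightarrow> 'b::topological_space. \<forall>i. f i \<in> S}"
proof -
  have "compactin (product_topology (\<lambda>i :: 'a. euclidean :: 'b topology) UNIV) (PiE UNIV (\<lambda>i. S))"
    using assms by (simp add: compactin_PiE)
  moreover have "PiE UNIV (\<lambda>i :: 'a. S) = {f. \<forall>i. f i \<in> S}"
    by (auto simp: PiE_def)
  ultimately show ?thesis
    by (simp add: euclidean_product_topology)
qed

lemma compact_Sp_bounded:
  assumes "n \<ge> 1"
  shows "compact {A \<in> Sp n. \<forall>i j. norm (A i j) \<le> K}"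
proof -
  have "compact {A :: qmat. \<forall>i. A i \<in> {f. \<forall>j. f j \<in> cball 0 K}}"
    by (intro compact_pointwise compact_cball)
  moreover have "{A \<in> Sp n. \<forall>i j. norm (A i j) \<le> K}
      = {A. \<forall>i. A i \<in> {f. \<forall>j. f j \<in> cball 0 K}} \<inter> Sp n"
    by auto
  ultimately show ?thesis
    using closed_Sp[OF assms] by (simp add: compact_Int_closed)
qed

lemma norm_supported_le:
  assumes "supported n A" "0 \<le> K" "\<And>i j. i \<in> idx n \<Longrightarrow> j \<in> idx n \<Longrightarrow> norm (A i j) \<le> K"
  shows "norm (A i j) \<le> K"
  using assms by (cases "i \<in> idx n \<and> j \<in> idx n") (auto simp: supported_def)

lemma locally_compact_space_Sp_top:
  assumes n: "n \<ge> 1"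
  shows "locally_compact_space (Sp_top n)"
  unfolding locally_compact_space_def topspace_Sp_top
proof
  fix A assume A: "A \<in> Sp n"
  define M where "M = Max ((\<lambda>(i, j). norm (A i j)) ` (idx n \<times> idx n))"
  define K where "K = M + 1"
  let ?U = "{B \<in> Sp n. \<forall>i\<in>idx n. \<forall>j\<in>idx n. norm (B i j) < K}"
  let ?C = "{B \<in> Sp n. \<forall>i j. norm (B i j) \<le> K}"
  have M: "norm (A i j) \<le> M" if "i \<in> idx n" "j \<in> idx n" for i j
    unfolding M_def using that by (intro Max_ge) force+
  then have "K > 0"
    using norm_ge_zero[of "A 1 1"] order_trans[of 0 "norm (A 1 1)" M] by (simp add: K_def)
  have "open (\<Inter>i\<in>idx n. \<Inter>j\<in>idx n. {B :: qmat. norm (B i j) < K})"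
    by (intro open_INT finite_idx ballI open_Collect_less continuous_on_norm continuous_on_qmat_nth
        continuous_on_id continuous_on_const)
  moreover have "?U = Sp n \<inter> (\<Inter>i\<in>idx n. \<Inter>j\<in>idx n. {B. norm (B i j) < K})"
    by auto
  ultimately have "openin (Sp_top n) ?U"
    unfolding Sp_top_def by (simp only: openin_open_Int)
  moreover have "compactin (Sp_top n) ?C"
    using compact_Sp_bounded[OF n, of K] by (simp add: Sp_top_def compactin_subtopology)
  moreover have "A \<in> ?U"
    using A M by (force simp: K_def)
  moreover have "?U \<subseteq> ?C"
  proof
    fix B assume B: "B \<in> ?U"
    have "norm (B i j) \<le> K" for i j
      by (rule norm_supported_le[of n B K])
        (use B \<open>K > 0\<close> supported_if_Sp[of B n] in \<open>auto intro: less_imp_le\<close>)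
    with B show "B \<in> ?C"
      by simp
  qed
  ultimately show "\<exists>U C. openin (Sp_top n) U \<and> compactin (Sp_top n) C \<and> A \<in> U \<and> U \<subseteq> C"
    by blast
qed

section \<open>The projective group PSp(n,1)\<close>

lemma pcls_eq_iff: "pcls A = pcls B \<longleftrightarrow> A = B \<or> A = - B"
  by (auto simp: pcls_def doubleton_eq_iff)

lemma carrier_PSp: "carrier (PSp n) = pcls ` Sp n"
  by (simp add: PSp_def PSp_carrier_def)

lemma PSp_mult_pcls: "pcls A \<otimes>\<^bsub>PSp n\<^esub> pcls B = pcls (qmat_mult n A B)"
proof -
  have "{qmat_mult n A' B' | A' B'. A' \<in> {A, - A} \<and> B' \<in> {B, - B}}
      = {qmat_mult n A B, qmat_mult n (- A) B, qmat_mult n A (- B), qmat_mult n (- A) (- B)}"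
    by blast
  then show ?thesis
    by (auto simp: PSp_def pcls_def uminus_qmat_eq_scale_qmat qmat_mult_scale_left
        qmat_mult_scale_right)
qed

lemma pcls_hom: "pcls \<in> hom (Sp_group n) (PSp n)"
  by (simp add: hom_def carrier_PSp PSp_mult_pcls)

lemma group_PSp:
  assumes "n \<ge> 1"
  shows "group (PSp n)"
  using group.hom_imp_img_group[OF group_Sp_group[OF assms] pcls_hom]
  by (simp add: PSp_def PSp_carrier_def)

lemma PSp_inv_pcls:
  assumes "n \<ge> 1" "A \<in> Sp n"
  shows "inv\<^bsub>PSp n\<^esub> (pcls A) = pcls (qadj n A)"
proof -
  interpret group_hom "Sp_group n" "PSp n" pcls
    using assms by (intro group_hom.intro group_hom_axioms.intro group_Sp_group group_PSp pcls_hom)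
  show ?thesis
    using hom_inv[of A] assms by (simp add: inv_Sp_group)
qed

lemma quotient_map_pcls: "quotient_map (Sp_top n) (PSp_top n) pcls"
proof -
  let ?P = "\<lambda>U. U \<subseteq> PSp_carrier n \<and> openin (Sp_top n) {A \<in> Sp n. pcls A \<in> U}"
  have "istopology ?P"
    unfolding istopology_def
  proof (intro conjI allI impI)
    fix S T assume "?P S" "?P T"
    moreover have "{A \<in> Sp n. pcls A \<in> S \<inter> T} = {A \<in> Sp n. pcls A \<in> S} \<inter> {A \<in> Sp n. pcls A \<in> T}"
      by auto
    ultimately show "S \<inter> T \<subseteq> PSp_carrier n" "openin (Sp_top n) {A \<in> Sp n. pcls A \<in> S \<inter> T}"
      by (auto simp: openin_Int)
  next
    fix \<K> assume "\<forall>K\<in>\<K>. ?P K"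
    moreover have "{A \<in> Sp n. pcls A \<in> \<Union>\<K>} = (\<Union>K\<in>\<K>. {A \<in> Sp n. pcls A \<in> K})"
      by auto
    ultimately show "\<Union>\<K> \<subseteq> PSp_carrier n" "openin (Sp_top n) {A \<in> Sp n. pcls A \<in> \<Union>\<K>}"
      by (auto simp: openin_Union)
  qed
  then have openin_iff: "openin (PSp_top n) U \<longleftrightarrow> ?P U" for U
    unfolding PSp_top_def by (simp add: topology_inverse')
  have "{A \<in> Sp n. pcls A \<in> PSp_carrier n} = topspace (Sp_top n)"
    by (auto simp: PSp_carrier_def)
  then have "openin (PSp_top n) (PSp_carrier n)"
    unfolding openin_iff by (simp only: openin_topspace order_refl simp_thms)
  then have "topspace (PSp_top n) = PSp_carrier n"
    using openin_iff openin_subset openin_topspace by (metis subset_antisym)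
  then show ?thesis
    unfolding quotient_map_def openin_iff by (auto simp: PSp_carrier_def)
qed

lemma topspace_PSp_top [simp]: "topspace (PSp_top n) = carrier (PSp n)"
  using quotient_imp_surjective_map[OF quotient_map_pcls, of n] by (simp add: carrier_PSp)

lemma continuous_map_pcls: "continuous_map (Sp_top n) (PSp_top n) pcls"
  by (rule quotient_imp_continuous_map[OF quotient_map_pcls])

lemma open_map_pcls:
  assumes n: "n \<ge> 1"
  shows "open_map (Sp_top n) (PSp_top n) pcls"
  unfolding open_map_def
proof (intro allI impI)
  fix U assume U: "openin (Sp_top n) U"
  then have U_sub: "U \<subseteq> Sp n"
    using openin_subset by fastforce
  have "continuous_on (Sp n) (\<lambda>A :: qmat. - A)"
    unfolding uminus_qmat_eq_scale_qmat by (intro continuous_on_scale_qmat continuous_on_id)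
  then have "continuous_map (Sp_top n) (Sp_top n) (\<lambda>A. - A)"
    using n by (auto simp: Sp_top_def continuous_map_in_subtopology Sp_uminus)
  from openin_continuous_map_preimage[OF this U]
  have "openin (Sp_top n) {A \<in> Sp n. - A \<in> U}"
    by simp
  moreover have "pcls A \<in> pcls ` U \<longleftrightarrow> A \<in> U \<or> - A \<in> U" for A
    unfolding image_iff pcls_eq_iff by (metis minus_minus)
  then have "{A \<in> Sp n. pcls A \<in> pcls ` U} = U \<union> {A \<in> Sp n. - A \<in> U}"
    using U_sub by blast
  ultimately have "openin (Sp_top n) {A \<in> topspace (Sp_top n). pcls A \<in> pcls ` U}"
    using U by (simp add: openin_Un)
  moreover have "pcls ` U \<subseteq> topspace (PSp_top n)"
    using U_sub by (auto simp: carrier_PSp)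
  ultimately show "openin (PSp_top n) (pcls ` U)"
    using quotient_map_pcls unfolding quotient_map_def by blast
qed

lemma topological_group_PSp:
  assumes "n \<ge> 1"
  shows "topological_group (PSp n) (PSp_top n)"
  by (rule topological_group_open_hom_image[OF topological_group_Sp_group[OF assms]
        group_PSp[OF assms] pcls_hom continuous_map_pcls open_map_pcls[OF assms]])
    (simp_all add: carrier_PSp)

lemma Hausdorff_space_PSp_top:
  assumes "n \<ge> 1"
  shows "Hausdorff_space (PSp_top n)"
proof (rule Hausdorff_space_open_map_image[OF open_map_pcls[OF assms]])
  have "closed {p :: qmat \<times> qmat. fst p = snd p \<or> fst p = - snd p}"
    unfolding uminus_qmat_eq_scale_qmat
    by (intro closed_Collect_disj closed_Collect_eq continuous_on_scale_qmat continuous_on_fst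
        continuous_on_snd continuous_on_id)
  then have "closedin (top_of_set (Sp n \<times> Sp n))
      (Sp n \<times> Sp n \<inter> {p. fst p = snd p \<or> fst p = - snd p})"
    by (rule closedin_closed_Int)
  moreover have "Sp n \<times> Sp n \<inter> {p. fst p = snd p \<or> fst p = - snd p}
      = {(A, B) \<in> topspace (Sp_top n) \<times> topspace (Sp_top n). pcls A = pcls B}"
    by (auto simp: pcls_eq_iff)
  ultimately show "closedin (prod_topology (Sp_top n) (Sp_top n))
      {(A, B) \<in> topspace (Sp_top n) \<times> topspace (Sp_top n). pcls A = pcls B}"
    by (simp only: prod_Sp_top)
qed (simp add: carrier_PSp)

lemma locally_compact_space_PSp_top: "n \<ge> 1 \<Longrightarrow> locally_compact_space (PSp_top n)"
  by (rule locally_compact_space_continuous_open_map_image[OF continuous_map_pcls open_map_pcls])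
    (simp_all add: carrier_PSp locally_compact_space_Sp_top)

abbreviation pcls2 :: "qmat \<times> qmat \<Rightarrow> qmat set \<times> qmat set" where
  "pcls2 \<equiv> map_prod pcls pcls"

lemma continuous_open_surjective_pcls2:
  assumes "n \<ge> 1"
  shows "continuous_map (top_of_set (Sp n \<times> Sp n)) (PSp2_top n) pcls2"
    and "open_map (top_of_set (Sp n \<times> Sp n)) (PSp2_top n) pcls2"
    and "pcls2 ` topspace (top_of_set (Sp n \<times> Sp n)) = topspace (PSp2_top n)"
  using continuous_map_map_prod[OF continuous_map_pcls continuous_map_pcls, of n n]
    open_map_prod[OF open_map_pcls open_map_pcls, of n n] assms
  by (simp_all add: prod_Sp_top PSp2_top_def map_prod_surj_on carrier_PSp)

lemma Lindelof_space_PSp2_top: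
  assumes "n \<ge> 1"
  shows "Lindelof_space (PSp2_top n)"
proof (rule second_countable_imp_Lindelof_space)
  show "second_countable (PSp2_top n)"
    by (rule second_countable_open_map_image[OF continuous_open_surjective_pcls2[OF assms]])
      (intro second_countable_subtopology second_countable_euclidean)
qed

lemma PSp2_mult_eq: "PSp2_mult n = (\<otimes>\<^bsub>PSp n \<times>\<times> PSp n\<^esub>)"
  by (intro ext) (simp add: PSp2_mult_def mult_DirProd')

lemma topological_group_PSp2:
  assumes "n \<ge> 1"
  shows "topological_group (PSp n \<times>\<times> PSp n) (PSp2_top n)"
  unfolding PSp2_top_def by (intro topological_group_DirProd topological_group_PSp assms)

text \<open>The representatives are chosen arbitrarily: changing a sign does not affect the defect.\<close>

definition class_defect :: "nat \<Rightarrow> qmat set \<times> qmat set \<Rightarrow> real" where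
  "class_defect n = (\<lambda>(X, Y). reversal_defect n (SOME A. A \<in> X) (SOME B. B \<in> Y))"

lemma class_defect_pcls [simp]: "class_defect n (pcls a, pcls b) = reversal_defect n a b"
proof -
  have sign: "\<exists>s::real. s ^ 4 = 1 \<and> (SOME B. B \<in> pcls A) = scale_qmat s A" for A
  proof -
    have "(SOME B. B \<in> pcls A) \<in> pcls A"
      by (rule someI[of _ A]) (simp add: pcls_def)
    then consider "(SOME B. B \<in> pcls A) = scale_qmat 1 A"
      | "(SOME B. B \<in> pcls A) = scale_qmat (- 1) A"
      by (auto simp: pcls_def uminus_qmat_eq_scale_qmat)
    then show ?thesis
      by cases (metis power_one, metis power_minus_even power_one even_numeral)
  qed
  from sign[of a] sign[of b] show ?thesis
    by (auto simp: class_defect_def reversal_defect_scale)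
qed

lemma continuous_map_class_defect:
  assumes "n \<ge> 1"
  shows "continuous_map (PSp2_top n) euclideanreal (class_defect n)"
proof (rule continuous_compose_quotient_map)
  show "quotient_map (top_of_set (Sp n \<times> Sp n)) (PSp2_top n) pcls2"
    by (rule continuous_open_imp_quotient_map[OF continuous_open_surjective_pcls2[OF assms]])
  have "class_defect n \<circ> pcls2 = (\<lambda>p. reversal_defect n (fst p) (snd p))"
    by (auto simp: fun_eq_iff)
  then show "continuous_map (top_of_set (Sp n \<times> Sp n)) euclideanreal (class_defect n \<circ> pcls2)"
    by (simp add: continuous_on_reversal_defect continuous_on_fst continuous_on_snd)
qed

lemma class_defect_eq_0_if_strongly_doubly_reversible:
  assumes n: "n \<ge> 1" and g: "g1 \<in> carrier (PSp n)" "g2 \<in> carrier (PSp n)"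
    and rev: "strongly_doubly_reversible (PSp n) g1 g2"
  shows "class_defect n (g1, g2) = 0"
proof -
  obtain a b where a: "a \<in> Sp n" "g1 = pcls a" and b: "b \<in> Sp n" "g2 = pcls b"
    using g by (auto simp: carrier_PSp)
  obtain h where h: "h \<in> Sp n"
    and ha: "pcls (qmat_conj n h a) = pcls (qadj n a)"
    and hb: "pcls (qmat_conj n h b) = pcls (qadj n b)"
    using rev n a b unfolding strongly_doubly_reversible_def
    by (auto simp: carrier_PSp PSp_mult_pcls PSp_inv_pcls qmat_mult_assoc qmat_conj_def)
  have "reversal_defect n a b = reversal_defect n (qmat_conj n h a) (qmat_conj n h b)"
    by (rule reversal_defect_conj[OF n h, symmetric])
  also have "\<dots> = reversal_defect n (qadj n a) (qadj n b)"
    using ha hb by (metis class_defect_pcls)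
  also have "\<dots> = - reversal_defect n a b"
    using a(1) b(1) by (intro reversal_defect_qadj supported_if_Sp)
  finally show ?thesis
    using a(2) b(2) by simp
qed

lemma ex_polynomial_curve_class_defect:
  assumes n: "n \<ge> 1" and y: "y \<in> carrier (PSp n \<times>\<times> PSp n)"
  shows "\<exists>\<gamma>. continuous_map euclideanreal (PSp2_top n) \<gamma> \<and> \<gamma> 0 = \<one>\<^bsub>PSp n \<times>\<times> PSp n\<^esub>
    \<and> (\<forall>w\<in>carrier (PSp n \<times>\<times> PSp n).
        real_polynomial_function (\<lambda>t. class_defect n (\<gamma> t \<otimes>\<^bsub>PSp n \<times>\<times> PSp n\<^esub> w)))
    \<and> (\<exists>t. class_defect n (\<gamma> t \<otimes>\<^bsub>PSp n \<times>\<times> PSp n\<^esub> y) \<noteq> 0)"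
proof -
  obtain a b where ab: "a \<in> Sp n" "b \<in> Sp n" "y = (pcls a, pcls b)"
    using y by (auto simp: carrier_PSp)
  obtain X1 X2 s where X: "\<And>t. X1 t \<in> Sp n" "\<And>t. X2 t \<in> Sp n" "X1 0 = qmat_id n" "X2 0 = qmat_id n"
    "qmat_polynomial X1" "qmat_polynomial X2"
    and s: "reversal_defect n (qmat_mult n (X1 s) a) (qmat_mult n (X2 s) b) \<noteq> 0"
    using ex_curves_reversal_defect_neq_0[OF n ab(1,2)] by metis
  define \<gamma> where "\<gamma> t = (pcls (X1 t), pcls (X2 t))" for t
  have \<gamma>_mult: "class_defect n (\<gamma> t \<otimes>\<^bsub>PSp n \<times>\<times> PSp n\<^esub> (pcls c, pcls d))
      = reversal_defect n (qmat_mult n (X1 t) c) (qmat_mult n (X2 t) d)" for t c d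
    by (simp add: \<gamma>_def PSp_mult_pcls)
  have "continuous_map euclideanreal (Sp_top n) X1" "continuous_map euclideanreal (Sp_top n) X2"
    using X(1,2,5,6)
    by (auto simp: Sp_top_def continuous_map_in_subtopology continuous_on_qmat_polynomial)
  then have "continuous_map euclideanreal (PSp2_top n) \<gamma>"
    unfolding \<gamma>_def PSp2_top_def
    by (intro continuous_map_pairedI
        continuous_map_compose[OF _ continuous_map_pcls, unfolded comp_def])
  moreover have "\<gamma> 0 = \<one>\<^bsub>PSp n \<times>\<times> PSp n\<^esub>"
    by (simp add: \<gamma>_def X(3,4)) (simp add: PSp_def)
  moreover have "real_polynomial_function (\<lambda>t. class_defect n (\<gamma> t \<otimes>\<^bsub>PSp n \<times>\<times> PSp n\<^esub> w))"
    if w: "w \<in> carrier (PSp n \<times>\<times> PSp n)" for w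
  proof -
    obtain c d where "w = (pcls c, pcls d)"
      using w by (auto simp: carrier_PSp)
    then show ?thesis
      unfolding \<open>w = _\<close> \<gamma>_mult
      by (intro real_polynomial_function_reversal_defect qmat_polynomial_mult
          qmat_polynomial_const X)
  qed
  moreover have "class_defect n (\<gamma> s \<otimes>\<^bsub>PSp n \<times>\<times> PSp n\<^esub> y) \<noteq> 0"
    using s by (simp only: ab(3) \<gamma>_mult not_False_eq_True)
  ultimately show ?thesis
    by blast
qed

theorem theorem4p1:
  fixes n :: nat
  assumes "n \<ge> 1"
  shows "haar_null (PSp2_top n) (PSp2_mult n)
           {(g1, g2). g1 \<in> carrier (PSp n) \<and> g2 \<in> carrier (PSp n)
                      \<and> strongly_doubly_reversible (PSp n) g1 g2}"
proof (rule haar_null_mono)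
  interpret topological_group "PSp n \<times>\<times> PSp n" "PSp2_top n"
    by (rule topological_group_PSp2[OF assms])
  have "locally_compact_space (PSp2_top n)" "Hausdorff_space (PSp2_top n)"
    unfolding PSp2_top_def locally_compact_space_prod_topology Hausdorff_space_prod_topology
    using locally_compact_space_PSp_top[OF assms] Hausdorff_space_PSp_top[OF assms] by blast+
  then show "haar_null (PSp2_top n) (PSp2_mult n)
      {x \<in> carrier (PSp n \<times>\<times> PSp n). class_defect n x = 0}"
    unfolding PSp2_mult_eq
    by (intro haar_null_zero_set Lindelof_space_PSp2_top continuous_map_class_defect
        ex_polynomial_curve_class_defect assms)
  show "{(g1, g2). g1 \<in> carrier (PSp n) \<and> g2 \<in> carrier (PSp n)
      \<and> strongly_doubly_reversible (PSp n) g1 g2}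
    \<subseteq> {x \<in> carrier (PSp n \<times>\<times> PSp n). class_defect n x = 0}"
    using class_defect_eq_0_if_strongly_doubly_reversible[OF assms] by auto
qed

end
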